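(* Let $P\subset\mathbb{R}^n$ be an $n$-dimensional polytope with vertices in $\mathbb{Z}^n$, and let $\rho(P)$ be the maximum, over all systems $f_1=\cdots=f_n=0$ of real polynomials $f_i\in\mathbb{R}[x_1,\ldots,x_n]$ with Newton polytope $\mathrm{New}(f_i)=P$ for all $i$ and having only finitely many (simple) solutions in $(\mathbb{C}^\times)^n$, of the number of solutions in $(\mathbb{R}^\times)^n$. Then for every regular triangulation $P_w$ of $P$, $$\#\{\text{odd cells of } P_w\}\ \le\ \rho(P).$$
   Context: The Newton polytope $\mathrm{New}(f)$ of a polynomial $f$ is the convex hull of the exponent vectors of its monomials. Given a lifting function $w\colon P\cap\mathbb{Z}^n\to\mathbb{Q}_{\ge0}$, let $Q=\mathrm{conv}\{(a,w(a)) : a\in P\cap\mathbb{Z}^n\}\subset\mathbb{R}^{n+1}$; its lower facets are those whose inward normal has positive last coordinate, and their projections to $\mathbb{R}^n$ form the regular subdivision $P_w$ of $P$. It is a regular triangulation if every lattice point of $P$ lifts to a vertex of a lower facet and all lower facets are simplices. The cells of $P_w$ are its full-dimensional simplices. For a lattice $n$-simplex $F$ with vertices $v_0,\ldots,v_n$, let $d_1\mid\cdots\mid d_n$ be the invariant factors (Smith normal form diagonal entries) of the integer matrix with columns $v_i-v_0$; $F$ is an odd cell if all $d_i$ are odd (equivalently its normalized volume $n!\,\mathrm{Vol}(F)=d_1\cdots d_n$ is odd). *)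

theory Defs
  imports "HOL-Analysis.Analysis"
begin

definition real_vec :: "int^'n \<Rightarrow> real^'n" where
  "real_vec a = (\<chi> i. of_int (a$i))"

definition lattice_pts :: "(real^'n) set \<Rightarrow> (int^'n) set" where
  "lattice_pts P = {a. real_vec a \<in> P}"

definition is_lattice_polytope :: "(real^'n) set \<Rightarrow> bool" where
  "is_lattice_polytope P \<longleftrightarrow> (\<exists>V. finite V \<and> P = convex hull (real_vec ` V))"

definition laurent_poly :: "(int^'n \<Rightarrow> real) \<Rightarrow> bool" where
  "laurent_poly c \<longleftrightarrow> finite {a. c a \<noteq> 0}"

definition mono :: "int^'n \<Rightarrow> complex^'n \<Rightarrow> complex" where
  "mono a x = (\<Prod>i\<in>UNIV. (x$i) powi (a$i))"

definition leval :: "(int^'n \<Rightarrow> real) \<Rightarrow> complex^'n \<Rightarrow> complex" where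
  "leval c x = (\<Sum>a\<in>{a. c a \<noteq> 0}. complex_of_real (c a) * mono a x)"

definition newton :: "(int^'n \<Rightarrow> real) \<Rightarrow> (real^'n) set" where
  "newton c = convex hull (real_vec ` {a. c a \<noteq> 0})"

definition torus_sols :: "('n \<Rightarrow> (int^'n \<Rightarrow> real)) \<Rightarrow> (complex^'n) set" where
  "torus_sols f = {x. (\<forall>i. x$i \<noteq> 0) \<and> (\<forall>j. leval (f j) x = 0)}"

definition jac :: "('n \<Rightarrow> (int^'n \<Rightarrow> real)) \<Rightarrow> complex^'n \<Rightarrow> complex^'n^'n" where
  "jac f x = (\<chi> j k. \<Sum>a\<in>{a. f j a \<noteq> 0}.
       complex_of_real (f j a) * of_int (a$k) * mono a x / x$k)"

definition real_sols :: "('n \<Rightarrow> (int^'n \<Rightarrow> real)) \<Rightarrow> (complex^'n) set" where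
  "real_sols f = {x \<in> torus_sols f. \<forall>i. Im (x$i) = 0}"

definition admissible_system :: "(real^'n) set \<Rightarrow> ('n \<Rightarrow> (int^'n \<Rightarrow> real)) \<Rightarrow> bool" where
  "admissible_system P f \<longleftrightarrow>
     (\<forall>j. laurent_poly (f j) \<and> newton (f j) = P) \<and>
     finite (torus_sols f) \<and> (\<forall>x\<in>torus_sols f. det (jac f x) \<noteq> 0)"

text \<open>The set whose maximum is rho(P).\<close>
definition real_counts :: "(real^'n) set \<Rightarrow> nat set" where
  "real_counts P = {card (real_sols f) | f. admissible_system P f}"

definition lifted_polytope :: "(real^'n) set \<Rightarrow> (int^'n \<Rightarrow> real) \<Rightarrow> ((real^'n) \<times> real) set" where
  "lifted_polytope P w = convex hull ((\<lambda>a. (real_vec a, w a)) ` lattice_pts P)"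

text \<open>Lower facets: n-dimensional faces on which a linear functional with inward normal
  (u,1) (positive last coordinate) attains its minimum over Q.\<close>
definition lower_facets :: "((real^'n) \<times> real) set \<Rightarrow> ((real^'n) \<times> real) set set" where
  "lower_facets Q = {F. \<exists>u c. (\<forall>q\<in>Q. u \<bullet> fst q + snd q \<ge> c) \<and>
      F = {q\<in>Q. u \<bullet> fst q + snd q = c} \<and> aff_dim F = int CARD('n)}"

definition regular_triangulation :: "(real^'n) set \<Rightarrow> (int^'n \<Rightarrow> real) \<Rightarrow> bool" where
  "regular_triangulation P w \<longleftrightarrow>
     (\<forall>a\<in>lattice_pts P. \<exists>F\<in>lower_facets (lifted_polytope P w).
         (real_vec a, w a) extreme_point_of F) \<and>
     (\<forall>F\<in>lower_facets (lifted_polytope P w). (int CARD('n)) simplex F)"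

definition cells :: "(real^'n) set \<Rightarrow> (int^'n \<Rightarrow> real) \<Rightarrow> (real^'n) set set" where
  "cells P w = (\<lambda>F. fst ` F) ` lower_facets (lifted_polytope P w)"

text \<open>Odd cell: lattice simplex with vertices v0, g(1..n) whose edge matrix (columns
  g j - v0) has odd determinant, i.e. odd normalized volume = product of invariant factors.\<close>
definition odd_cell :: "(real^'n) set \<Rightarrow> bool" where
  "odd_cell S \<longleftrightarrow> (\<exists>v0 (g :: 'n \<Rightarrow> int^'n).
      {x. x extreme_point_of S} = insert (real_vec v0) (real_vec ` range g) \<and>
      odd (det (\<chi> i j. (g j - v0) $ i)))"

end

theory Submission
  imports Defs "HOL-Library.Z2" "HOL-Computational_Algebra.Polynomial"
begin

text \<open>
  Viro's method. Take \<open>f j = (\<Sum>a. \<tau> a ^ j * exp (- T * w a) * x ^ a)\<close> with distinct positive \<open>\<tau> a\<close>, so that by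
  Vandermonde any \<open>n\<close> columns of the coefficient matrix are linearly independent, and let \<open>T\<close>
  grow. Along solutions in the complex torus, the terms of maximal order must number more than \<open>n\<close>;
  since a set of exponents that are nearly minimal for a common functional lies in one simplex of the
  triangulation, they are exactly the vertices of one cell. In the limit this makes every solution
  nondegenerate and bounds the solution set inside the torus, so it is finite. Conversely, near each
  cell with functional \<open>(u, 1)\<close> the substitution \<open>x = s exp (\<eta> - T u)\<close> turns the
  system into a perturbation of a binomial one. For an odd cell the signs \<open>s\<close> can be
  chosen by solving a linear system modulo 2, and Brouwer's theorem yields \<open>\<eta>\<close>. Distinct
  cells have distinct \<open>u\<close>, hence distinct real solutions for large \<open>T\<close>.
\<close>

subsection \<open>Lower facets cover the polytope\<close>

lemma lower_facet_face_of:
  fixes Q :: "((real^'n) \<times> real) set"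
  assumes "convex Q" "F \<in> lower_facets Q"
  shows "F face_of Q"
proof -
  obtain u c where uc: "\<forall>q\<in>Q. u \<bullet> fst q + snd q \<ge> c" "F = {q\<in>Q. u \<bullet> fst q + snd q = c}"
    using assms(2) by (auto simp: lower_facets_def)
  have "(u, 1) \<bullet> q = u \<bullet> fst q + snd q" for q :: "(real^'n) \<times> real"
    by (simp add: inner_prod_def)
  then have "F = Q \<inter> {q. (u, 1) \<bullet> q = c}" and "\<And>q. q \<in> Q \<Longrightarrow> (u, 1) \<bullet> q \<ge> c"
    using uc by auto
  then show ?thesis
    using face_of_Int_supporting_hyperplane_ge[OF assms(1)] by metis
qed

text \<open>The lowest point of \<open>Q\<close> over \<open>b\<close> lies on the relative frontier
  of the thickened polytope \<open>Q'\<close>, hence on a facet of it. As \<open>b\<close> is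
  interior to the projection, the supporting hyperplane is not vertical, and as \<open>Q'\<close>
  extends upwards there, its outer normal points down; dividing by the last coordinate gives
  \<open>(u, 1)\<close>.\<close>

lemma interior_covered_by_lower_facet:
  fixes Q :: "((real^'n) \<times> real) set"
  assumes Q: "polytope Q" and b: "b \<in> interior (fst ` Q)"
  shows "\<exists>F\<in>lower_facets Q. b \<in> fst ` F"
proof -
  \<comment> \<open>Thickening \<open>Q\<close> upwards makes it full-dimensional without changing its lowest points.\<close>
  define Q' where "Q' = (\<lambda>p :: ((real^'n) \<times> real) \<times> real. fst p + (0, snd p)) ` (Q \<times> {0..1})"
  have "linear (\<lambda>p :: ((real^'n) \<times> real) \<times> real. fst p + (0, snd p))"
    by (rule linearI) (auto simp: algebra_simps)
  moreover have "polytope {0..1::real}"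
    using polytope_interval[of "0::real" 1] by (simp add: cbox_interval)
  ultimately have poly': "polytope Q'"
    unfolding Q'_def by (intro polytope_linear_image polytope_Times Q)
  have mem': "(x, s) \<in> Q' \<longleftrightarrow> (\<exists>s0\<in>{s-1..s}. (x, s0) \<in> Q)" for x s
    by (force simp: Q'_def image_iff Bex_def intro: exI[of _ "s - _"])
  have "compact (Q \<inter> {q. fst q = b})"
    by (intro compact_Int_closed polytope_imp_compact Q closed_Collect_eq continuous_intros)
  moreover have "Q \<inter> {q. fst q = b} \<noteq> {}"
    using b interior_subset by fastforce
  ultimately obtain q where "q \<in> Q \<inter> {q. fst q = b}"
      "\<And>q'. q' \<in> Q \<inter> {q. fst q = b} \<Longrightarrow> snd q \<le> snd q'"
    using continuous_attains_inf[of "Q \<inter> {q. fst q = b}" snd] continuous_on_snd[OF continuous_on_id]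
    by fastforce
  then obtain h where h: "(b, h) \<in> Q" "\<And>s. (b, s) \<in> Q \<Longrightarrow> h \<le> s"
    by (cases q) auto
  \<comment> \<open>Excludes vertical supporting hyperplanes at \<open>(b, h)\<close>:
    \<open>b\<close> can be moved a little in the direction \<open>v1\<close> within the projection,
    which would raise the functional. This serves both for the full dimension of \<open>Q'\<close>
    and for the slope of the facet.\<close>
  have nonint: "v2 \<noteq> 0 \<or> v1 = 0" if le: "\<And>q. q \<in> Q' \<Longrightarrow> (v1, v2) \<bullet> q \<le> (v1, v2) \<bullet> (b, h)" for v1 v2
  proof (rule ccontr)
    assume "\<not> ?thesis"
    then have v: "v2 = 0" "v1 \<noteq> 0" by auto
    obtain e where e: "e > 0" "cball b e \<subseteq> fst ` Q"
      using b by (meson mem_interior_cball)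
    have "b + (e / norm v1) *\<^sub>R v1 \<in> cball b e"
      using v e by (simp add: dist_norm)
    then obtain s where "(b + (e / norm v1) *\<^sub>R v1, s) \<in> Q" using e by force
    then have "(b + (e / norm v1) *\<^sub>R v1, s) \<in> Q'" by (auto simp: mem')
    from le[OF this] have "(e / norm v1) * (v1 \<bullet> v1) \<le> 0"
      using v by (simp add: inner_right_distrib)
    moreover have "(e / norm v1) * (v1 \<bullet> v1) > 0" using v e by simp
    ultimately show False by linarith
  qed
  have bh': "(b, h) \<in> Q'" "(b, h + 1) \<in> Q'" using h by (auto simp: mem' intro: bexI[of _ h])
  have "interior Q' \<noteq> {}"
  proof
    assume "interior Q' = {}"
    then obtain v \<beta> where v: "v \<noteq> 0" "Q' \<subseteq> {x. v \<bullet> x = \<beta>}"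
      using empty_interior_subset_hyperplane[OF polytope_imp_convex[OF poly']] by blast
    obtain v1 v2 where vv: "v = (v1, v2)" by (cases v)
    have eq: "(v1, v2) \<bullet> q = (v1, v2) \<bullet> (b, h)" if "q \<in> Q'" for q
      using v(2) bh'(1) that unfolding vv by (metis (mono_tags, lifting) mem_Collect_eq subsetD)
    from eq[OF bh'(2)] have "v2 = 0" by (simp add: algebra_simps)
    with nonint[of v1 v2] eq v vv show False by (auto simp: zero_prod_def)
  qed
  then have dim': "aff_dim Q' = int CARD('n) + 1"
    using aff_dim_nonempty_interior[of Q'] by simp
  have "(b, h) \<notin> rel_interior Q'"
  proof
    assume "(b, h) \<in> rel_interior Q'"
    then have "(b, h) \<in> interior Q'"
      using \<open>interior Q' \<noteq> {}\<close> rel_interior_nonempty_interior by blast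
    then obtain e where e: "e > 0" "cball (b, h) e \<subseteq> Q'" by (meson mem_interior_cball)
    have "(b, h - e) \<in> cball (b, h) e" using e by (simp add: dist_norm norm_Pair)
    then have "(b, h - e) \<in> Q'" using e by blast
    then obtain s where "(b, s) \<in> Q" "s \<le> h - e" by (auto simp: mem')
    with h(2)[of s] e show False by auto
  qed
  then have "(b, h) \<in> rel_frontier Q'"
    using bh' closure_subset by (auto simp: rel_frontier_def)
  then obtain F where F: "F facet_of Q'" "(b, h) \<in> F"
    using rel_frontier_of_polyhedron[OF polytope_imp_polyhedron[OF poly']] by auto
  then have "F exposed_face_of Q'"
    by (simp add: exposed_face_of_polyhedron[OF polytope_imp_polyhedron[OF poly']] facet_of_imp_face_of)
  then obtain v \<beta> where v: "Q' \<subseteq> {x. v \<bullet> x \<le> \<beta>}" "F = Q' \<inter> {x. v \<bullet> x = \<beta>}"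
    by (auto simp: exposed_face_of_def)
  obtain v1 v2 where vv: "v = (v1, v2)" by (cases v)
  have \<beta>: "\<beta> = (v1, v2) \<bullet> (b, h)" using F v vv by auto
  have le: "(v1, v2) \<bullet> q \<le> (v1, v2) \<bullet> (b, h)" if "q \<in> Q'" for q
    using v that \<beta> vv by auto
  have "v2 \<noteq> 0"
  proof
    assume "v2 = 0"
    then have "v = 0" using nonint[of v1 v2] le vv by (auto simp: zero_prod_def)
    then have "F = Q'" using v \<beta> vv by (auto simp: zero_prod_def)
    then show False using F by simp
  qed
  moreover have "v2 \<le> 0" using le[OF bh'(2)] by (simp add: algebra_simps)
  ultimately have v2: "v2 < 0" by simp
  define u where "u = (1 / v2) *\<^sub>R v1"
  define c where "c = \<beta> / v2"
  have scale: "(v1, v2) \<bullet> q = v2 * (u \<bullet> fst q + snd q)" for q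
    using v2 by (simp add: inner_prod_def u_def field_simps)
  have \<beta>c: "\<beta> = v2 * c" using v2 by (simp add: c_def)
  have ge: "u \<bullet> x + s \<ge> c" if "(x, s) \<in> Q'" for x s
    using le[OF that, folded \<beta>] scale[of "(x, s)"] v2 by (auto simp: \<beta>c)
  have F': "(x, s) \<in> F \<longleftrightarrow> (x, s) \<in> Q' \<and> u \<bullet> x + s = c" for x s
    using v2 unfolding v(2) vv by (auto simp: scale \<beta>c)
  have QQ': "(x, s) \<in> Q'" if "(x, s) \<in> Q" for x s
    using that by (auto simp: mem' intro: bexI[of _ s])
  have "F = {q \<in> Q. u \<bullet> fst q + snd q = c}"
  proof (rule set_eqI)
    fix q :: "(real^'n) \<times> real"
    obtain x s where q: "q = (x, s)" by (cases q)
    \<comment> \<open>A point of \<open>F\<close> with positive added height would lie above a point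
      of \<open>Q\<close> where the functional is below its minimum \<open>c\<close>.\<close>
    have "(x, s) \<in> Q" if *: "(x, s) \<in> Q'" "u \<bullet> x + s = c"
    proof -
      obtain s0 where s0: "s0 \<le> s" "(x, s0) \<in> Q" using *(1)[unfolded mem'] by auto
      with ge[OF QQ'[OF s0(2)]] *(2) show ?thesis by (cases "s0 = s") auto
    qed
    then show "q \<in> F \<longleftrightarrow> q \<in> {q \<in> Q. u \<bullet> fst q + snd q = c}"
      using QQ' by (auto simp: q F')
  qed
  moreover have "\<forall>q\<in>Q. u \<bullet> fst q + snd q \<ge> c" using ge QQ' by auto
  moreover have "aff_dim F = int CARD('n)" using F(1) dim' by (simp add: facet_of_def)
  ultimately have "F \<in> lower_facets Q" by (auto simp: lower_facets_def)
  then show ?thesis using F(2) by force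
qed

lemma finite_lower_facets:
  assumes "polytope Q" shows "finite (lower_facets Q)"
  using finite_polytope_faces[OF assms] lower_facet_face_of[OF polytope_imp_convex[OF assms]]
  by (metis (no_types, lifting) finite_subset mem_Collect_eq subsetI)

text \<open>Boundary points are reached as limits: the projections of finitely many compact facets
  have a closed union, and a convex set with nonempty interior lies in the closure of its
  interior.\<close>

lemma lower_facets_cover:
  fixes Q :: "((real^'n) \<times> real) set"
  assumes Q: "polytope Q" and int: "interior (fst ` Q) \<noteq> {}"
  shows "fst ` Q \<subseteq> (\<Union>F\<in>lower_facets Q. fst ` F)"
proof -
  have "convex (fst ` Q)" and "compact (fst ` Q)"
    using polytope_linear_image[OF linear_fst Q] polytope_imp_convex polytope_imp_compact by blast+
  then have "fst ` Q \<subseteq> closure (interior (fst ` Q))"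
    using convex_closure_interior int closure_subset by metis
  also have "\<dots> \<subseteq> (\<Union>F\<in>lower_facets Q. fst ` F)"
  proof (rule closure_minimal)
    show "interior (fst ` Q) \<subseteq> (\<Union>F\<in>lower_facets Q. fst ` F)"
      using interior_covered_by_lower_facet[OF Q] by blast
    have "compact F" if "F \<in> lower_facets Q" for F
      using lower_facet_face_of[OF polytope_imp_convex[OF Q] that] face_of_imp_compact
        polytope_imp_compact[OF Q] polytope_imp_convex[OF Q] by blast
    then show "closed (\<Union>F\<in>lower_facets Q. fst ` F)"
      by (intro closed_UN ballI finite_lower_facets[OF Q] compact_imp_closed)
        (auto intro!: compact_continuous_image continuous_intros)
  qed
  finally show ?thesis .
qed

subsection \<open>Simplices of the triangulation\<close>

lemma inj_real_vec: "inj real_vec"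
  by (auto simp: inj_on_def real_vec_def vec_eq_iff)

lemma finite_lattice_pts:
  fixes P :: "(real^'n) set"
  assumes "bounded P" shows "finite (lattice_pts P)"
proof -
  obtain N where N: "\<And>x. x \<in> P \<Longrightarrow> norm x \<le> real N"
    using assms by (metis bounded_iff order_trans real_arch_simple)
  have "lattice_pts P \<subseteq> vec_lambda ` (UNIV \<rightarrow>\<^sub>E {- int N..int N})"
  proof
    fix a assume "a \<in> lattice_pts P"
    then have "\<bar>real_vec a $ i\<bar> \<le> real N" for i
      using N component_le_norm_cart[of "real_vec a" i] by (fastforce simp: lattice_pts_def)
    then have "a $ i \<in> {- int N..int N}" for i
      by (simp add: real_vec_def abs_le_iff flip: of_int_abs) (metis abs_le_iff neg_le_iff_le
        minus_le_iff of_int_le_iff of_int_of_nat_eq)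
    then have "vec_nth a \<in> UNIV \<rightarrow>\<^sub>E {- int N..int N}" by auto
    then show "a \<in> vec_lambda ` (UNIV \<rightarrow>\<^sub>E {- int N..int N})"
      by (metis image_eqI vec_nth_inverse)
  qed
  then show ?thesis by (rule finite_subset) (intro finite_imageI finite_PiE; simp)
qed

definition tight :: "(int^'n) set \<Rightarrow> (int^'n \<Rightarrow> real) \<Rightarrow> real^'n \<Rightarrow> real \<Rightarrow> (int^'n) set" where
  "tight A w u c = {a\<in>A. u \<bullet> real_vec a + w a = c}"

text \<open>A cell is represented by its functional \<open>(u, 1)\<close> and the minimum
  \<open>c\<close> instead of as a face of the lifted polytope. Cardinality and dimension together
  say that the exponents attaining the minimum are affinely independent, hence the vertices of an
  \<open>n\<close>-simplex.\<close>

definition lower_simplex :: "(int^'n) set \<Rightarrow> (int^'n \<Rightarrow> real) \<Rightarrow> real^'n \<Rightarrow> real \<Rightarrow> bool" where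
  "lower_simplex A w u c \<longleftrightarrow> (\<forall>a\<in>A. c \<le> u \<bullet> real_vec a + w a) \<and>
     card (tight A w u c) = CARD('n) + 1 \<and> aff_dim (real_vec ` tight A w u c) = int CARD('n)"

text \<open>A facet that is a simplex could still carry lifted lattice points that are not vertices.
  The hypothesis \<open>ext\<close> rules this out, so exactly \<open>n + 1\<close> exponents are
  tight. Their dimension is that of the facet, because lifting onto it is an injective affine
  map.\<close>

lemma lower_facet_imp_lower_simplex:
  fixes A :: "(int^'n) set" and w :: "int^'n \<Rightarrow> real"
  defines "Q \<equiv> convex hull ((\<lambda>a. (real_vec a, w a)) ` A)"
  assumes fin: "finite A"
    and ext: "\<forall>a\<in>A. \<exists>F\<in>lower_facets Q. (real_vec a, w a) extreme_point_of F"
    and F: "F \<in> lower_facets Q" "int CARD('n) simplex F"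
  obtains u c where "lower_simplex A w u c" "fst ` F = convex hull (real_vec ` tight A w u c)"
proof -
  define l where "l = (\<lambda>a. (real_vec a, w a))"
  have Q: "Q = convex hull (l ` A)" by (simp add: Q_def l_def)
  have lQ: "a \<in> A \<Longrightarrow> l a \<in> Q" for a by (simp add: Q hull_inc)
  obtain u c where uc: "\<forall>q\<in>Q. u \<bullet> fst q + snd q \<ge> c" "F = {q\<in>Q. u \<bullet> fst q + snd q = c}"
      "aff_dim F = int CARD('n)"
    using F(1) by (auto simp: lower_facets_def)
  define T where "T = tight A w u c"
  have "convex Q" by (simp add: Q)
  note face = lower_facet_face_of[OF this]
  have lT: "l a \<in> F \<longleftrightarrow> a \<in> T" if "a \<in> A" for a
    using that lQ[OF that] by (simp add: uc(2) T_def tight_def l_def)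
  have TA: "T \<subseteq> A" by (auto simp: T_def tight_def)
  obtain S where S: "S \<subseteq> l ` A" "F = convex hull S"
    using face_of_convex_hull_subset[of "l ` A" F] face[OF F(1)] fin
    by (metis Q finite_imageI finite_imp_compact)
  have "S \<subseteq> l ` T" using S lT hull_subset[of S convex] by blast
  then have "F \<subseteq> convex hull (l ` T)" using S(2) hull_mono by metis
  moreover have "convex F" using S(2) by simp
  ultimately have FT: "F = convex hull (l ` T)"
    using lT TA by (intro antisym hull_minimal) auto
  then have fstF: "fst ` F = convex hull (real_vec ` T)"
    by (simp add: convex_hull_linear_image[OF linear_fst] image_image l_def)
  have Tc: "w a = c - u \<bullet> real_vec a" if "a \<in> T" for a
    using that by (auto simp: T_def tight_def)
  define L where "L x = (x, - (u \<bullet> x))" for x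
  have linL: "linear L" by (rule linearI) (auto simp: L_def inner_right_distrib)
  have injL: "inj L" by (auto simp: L_def inj_on_def)
  have "l ` T = (+) (0, c) ` L ` real_vec ` T"
    unfolding image_image by (rule image_cong) (auto simp: l_def L_def Tc)
  then have "aff_dim F = aff_dim (real_vec ` T)"
    using FT linL injL by (simp add: aff_dim_convex_hull aff_dim_translation_eq)
  then have dim: "aff_dim (real_vec ` T) = int CARD('n)" using uc(3) by simp
  obtain C where C: "\<not> affine_dependent C" "int (card C) = int CARD('n) + 1" "F = convex hull C"
    using F(2) by (auto simp: simplex_def)
  \<comment> \<open>The facet \<open>F'\<close> supplied by \<open>ext\<close> may differ from
    \<open>F\<close>; extremality passes from \<open>F'\<close> up to \<open>Q\<close> and then down
    to \<open>F\<close>.\<close>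
  have "l a \<in> C" if a: "a \<in> T" for a
  proof -
    obtain F' where "F' \<in> lower_facets Q" "l a extreme_point_of F'"
      using ext a TA by (auto simp: l_def)
    then have "l a extreme_point_of Q" using extreme_point_of_face[OF face] by blast
    then have "l a extreme_point_of F" using extreme_point_of_face[OF face[OF F(1)]] lT that TA by blast
    then show ?thesis using extreme_point_of_convex_hull C(3) by blast
  qed
  moreover have "x \<in> l ` T" if "x \<in> C" for x
    using that extreme_point_of_convex_hull_affine_independent[OF C(1)] C(3) FT
      extreme_point_of_convex_hull by metis
  ultimately have "C = l ` T" by auto
  moreover have "inj_on l T" using inj_real_vec by (auto simp: l_def inj_on_def)
  ultimately have "card T = CARD('n) + 1" using C(2) by (simp add: card_image)
  moreover have "\<forall>a\<in>A. c \<le> u \<bullet> real_vec a + w a"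
    using bspec[OF uc(1) lQ] by (simp add: l_def)
  ultimately show ?thesis
    using that[of u c] dim fstF by (simp add: lower_simplex_def T_def)
qed

text \<open>A nonzero \<open>v\<close> would confine a full-dimensional simplex to a hyperplane.
  Both limit arguments for complex solutions end with this contradiction.\<close>

lemma lower_simplex_spanning:
  fixes A :: "(int^'n) set"
  assumes "lower_simplex A w u c" and "\<And>a. a \<in> tight A w u c \<Longrightarrow> v \<bullet> real_vec a = k"
  shows "v = 0"
proof (rule ccontr)
  assume "v \<noteq> 0"
  have "real_vec ` tight A w u c \<subseteq> {x. v \<bullet> x = k}" using assms(2) by auto
  then have "aff_dim (real_vec ` tight A w u c) \<le> aff_dim {x. v \<bullet> x = k}" by (rule aff_dim_subset)
  also have "\<dots> = int CARD('n) - 1" using \<open>v \<noteq> 0\<close> by (simp add: aff_dim_hyperplane)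
  finally show False using assms(1) by (simp add: lower_simplex_def)
qed

text \<open>If \<open>M\<close> were not contained in the simplex below its barycenter, then by strict
  lower convexity the average of the lifted heights over \<open>M\<close> would exceed the height of the facet there.\<close>

lemma barycenter_gap:
  fixes A :: "(int^'n) set"
  assumes "finite A" "M \<subseteq> A" "M \<noteq> {}" and ls: "lower_simplex A w u c"
    and bary: "(\<Sum>a\<in>M. (1 / real (card M)) *\<^sub>R real_vec a) \<in> convex hull (real_vec ` tight A w u c)"
    and nsub: "\<not> M \<subseteq> tight A w u c"
  obtains \<eta> where "\<eta> > 0"
    "\<And>x y z m. \<lbrakk>\<And>a. a \<in> A \<Longrightarrow> x \<bullet> real_vec a - y * w a \<le> z;
       \<And>a. a \<in> M \<Longrightarrow> m \<le> x \<bullet> real_vec a - y * w a\<rbrakk> \<Longrightarrow> m + y * \<eta> \<le> z"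
proof -
  define T where "T = tight A w u c"
  have T: "T \<subseteq> A" "finite T" using assms(1) by (auto simp: T_def tight_def)
  have M: "finite M" "card M > 0" using assms finite_subset card_gt_0_iff by metis+
  have "convex hull (real_vec ` T) =
     {\<Sum>x\<in>real_vec ` T. l x *\<^sub>R x | l. (\<forall>x\<in>real_vec ` T. 0 \<le> l x) \<and> sum l (real_vec ` T) = 1}"
    by (subst convex_hull_finite) (use T in auto)
  then obtain l where l: "\<forall>x\<in>real_vec ` T. 0 \<le> l x" "sum l (real_vec ` T) = 1"
      "(\<Sum>a\<in>M. (1 / real (card M)) *\<^sub>R real_vec a) = (\<Sum>x\<in>real_vec ` T. l x *\<^sub>R x)"
    using bary unfolding T_def by auto
  define \<mu> where "\<mu> a = l (real_vec a)" for a
  have inj: "inj_on real_vec T" using inj_real_vec by (auto simp: inj_on_def)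
  have \<mu>: "\<And>a. a \<in> T \<Longrightarrow> 0 \<le> \<mu> a" "sum \<mu> T = 1"
      "(\<Sum>a\<in>M. (1 / real (card M)) *\<^sub>R real_vec a) = (\<Sum>a\<in>T. \<mu> a *\<^sub>R real_vec a)"
    using l inj by (auto simp: \<mu>_def sum.reindex)
  have bary_inner: "(\<Sum>a\<in>M. x \<bullet> real_vec a) = real (card M) * (\<Sum>a\<in>T. \<mu> a * (x \<bullet> real_vec a))" for x
  proof -
    have "x \<bullet> (\<Sum>a\<in>M. (1 / real (card M)) *\<^sub>R real_vec a) = x \<bullet> (\<Sum>a\<in>T. \<mu> a *\<^sub>R real_vec a)"
      using \<mu>(3) by simp
    then have "(\<Sum>a\<in>M. x \<bullet> real_vec a) / real (card M) = (\<Sum>a\<in>T. \<mu> a * (x \<bullet> real_vec a))"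
      by (simp add: inner_sum_right sum_divide_distrib)
    then show ?thesis using M(2) by (subst (asm) nonzero_divide_eq_eq) (auto simp: mult.commute)
  qed
  define \<eta> where "\<eta> = (\<Sum>a\<in>M. w a) / real (card M) - (\<Sum>a\<in>T. \<mu> a * w a)"
  have Tc: "w a = c - u \<bullet> real_vec a" if "a \<in> T" for a
    using that by (auto simp: T_def tight_def)
  have ge: "\<forall>a\<in>A. c \<le> u \<bullet> real_vec a + w a" using ls by (simp add: lower_simplex_def)
  obtain a0 where a0: "a0 \<in> M" "a0 \<notin> T" using nsub by (auto simp: T_def)
  have "(\<Sum>a\<in>M. c) < (\<Sum>a\<in>M. u \<bullet> real_vec a + w a)"
  proof (rule sum_strict_mono_ex1)
    show "\<forall>a\<in>M. c \<le> u \<bullet> real_vec a + w a" using ge assms by blast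
    show "\<exists>a\<in>M. c < u \<bullet> real_vec a + w a"
      using a0 ge assms(2) by (intro bexI[of _ a0]) (auto simp: T_def tight_def order.strict_iff_order)
  qed (use M in auto)
  also have "\<dots> = real (card M) * (\<Sum>a\<in>T. \<mu> a * (u \<bullet> real_vec a)) + (\<Sum>a\<in>M. w a)"
    by (simp add: sum.distrib bary_inner)
  finally have "real (card M) * c < real (card M) * (\<Sum>a\<in>T. \<mu> a * (u \<bullet> real_vec a)) + (\<Sum>a\<in>M. w a)"
    by simp
  from divide_strict_right_mono[OF this, of "real (card M)"]
  have "c < (\<Sum>a\<in>T. \<mu> a * (u \<bullet> real_vec a)) + (\<Sum>a\<in>M. w a) / real (card M)"
    using M(2) by (simp add: add_divide_distrib)
  moreover have "(\<Sum>a\<in>T. \<mu> a * w a) = c - (\<Sum>a\<in>T. \<mu> a * (u \<bullet> real_vec a))"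
  proof -
    have "(\<Sum>a\<in>T. \<mu> a * w a) = (\<Sum>a\<in>T. \<mu> a * c - \<mu> a * (u \<bullet> real_vec a))"
      by (rule sum.cong) (auto simp: Tc algebra_simps)
    then show ?thesis by (simp add: sum_subtractf \<mu>(2) flip: sum_distrib_right)
  qed
  ultimately have "\<eta> > 0" by (simp add: \<eta>_def)
  \<comment> \<open>Here \<open>x\<close> stands for the log norms of a solution, \<open>y\<close>
    for the Viro parameter, \<open>z\<close> and \<open>m\<close> for logarithmic bounds on the
    terms. Averaging the lower bounds over \<open>M\<close> and the upper bounds with weights
    \<open>\<mu>\<close> cancels \<open>x\<close>, since both averages have the same barycenter;
    only the heights remain, and they differ by \<open>\<eta>\<close>.\<close>
  moreover have "m + y * \<eta> \<le> z"
    if *: "\<And>a. a \<in> A \<Longrightarrow> x \<bullet> real_vec a - y * w a \<le> z"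
      "\<And>a. a \<in> M \<Longrightarrow> m \<le> x \<bullet> real_vec a - y * w a" for x y z m
  proof -
    have "real (card M) * m \<le> (\<Sum>a\<in>M. x \<bullet> real_vec a - y * w a)"
      using sum_bounded_below[of M m] *(2) by simp
    also have "\<dots> = real (card M) * (\<Sum>a\<in>T. \<mu> a * (x \<bullet> real_vec a)) - y * (\<Sum>a\<in>M. w a)"
      by (simp add: sum_subtractf bary_inner sum_distrib_left)
    finally have "real (card M) * m \<le>
      real (card M) * (\<Sum>a\<in>T. \<mu> a * (x \<bullet> real_vec a)) - y * (\<Sum>a\<in>M. w a)" .
    from divide_right_mono[OF this, of "real (card M)"]
    have "m \<le> (\<Sum>a\<in>T. \<mu> a * (x \<bullet> real_vec a)) - y * (\<Sum>a\<in>M. w a) / real (card M)"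
      using M(2) by (simp add: diff_divide_distrib)
    also have "\<dots> = (\<Sum>a\<in>T. \<mu> a * (x \<bullet> real_vec a - y * w a)) - y * \<eta>"
      by (simp add: \<eta>_def algebra_simps sum_subtractf sum_distrib_left)
    also have "(\<Sum>a\<in>T. \<mu> a * (x \<bullet> real_vec a - y * w a)) \<le> (\<Sum>a\<in>T. \<mu> a * z)"
      using *(1) \<mu>(1) T by (intro sum_mono mult_left_mono) auto
    also have "\<dots> = z" by (simp add: \<mu>(2) flip: sum_distrib_right)
    finally show ?thesis by simp
  qed
  ultimately show ?thesis using that by blast
qed

text \<open>Lagrange interpolation on the support of \<open>z\<close>.\<close>

lemma vandermonde_kernel_trivial:
  fixes z :: "'a \<Rightarrow> 'k :: real_normed_field" and \<tau> :: "'a \<Rightarrow> real"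
  assumes "finite M" "card M \<le> n" "inj_on \<tau> M"
    and eq: "\<And>i. i < n \<Longrightarrow> (\<Sum>a\<in>M. of_real (\<tau> a ^ i) * z a) = 0"
    and a: "a \<in> M"
  shows "z a = 0"
proof -
  define p :: "'k poly" where "p = (\<Prod>b\<in>M - {a}. [:- of_real (\<tau> b), 1:])"
  have "degree p \<le> (\<Sum>b\<in>M - {a}. degree [:- of_real (\<tau> b), 1 :: 'k:])"
    unfolding p_def by (rule degree_prod_sum_le[unfolded comp_def]) (use assms in auto)
  then have "degree p \<le> card (M - {a})" by simp
  moreover have "card (M - {a}) < card M" using assms by (intro psubset_card_mono) auto
  ultimately have deg: "degree p < n" using assms(2) by linarith
  have "(\<Sum>b\<in>M. poly p (of_real (\<tau> b)) * z b)
      = (\<Sum>i\<le>degree p. \<Sum>b\<in>M. coeff p i * (of_real (\<tau> b ^ i) * z b))"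
    by (simp add: poly_altdef sum_distrib_right mult.assoc sum.swap[of _ M])
  also have "\<dots> = (\<Sum>i\<le>degree p. coeff p i * (\<Sum>b\<in>M. of_real (\<tau> b ^ i) * z b))"
    by (simp only: sum_distrib_left)
  also have "\<dots> = 0"
    using eq deg by (intro sum.neutral) (metis atMost_iff le_less_trans mult_zero_right)
  finally have "(\<Sum>b\<in>M. poly p (of_real (\<tau> b)) * z b) = 0" .
  moreover have "(\<Sum>b\<in>M. poly p (of_real (\<tau> b)) * z b) = poly p (of_real (\<tau> a)) * z a"
  proof -
    have "poly p (of_real (\<tau> b)) = 0" if "b \<in> M - {a}" for b
      unfolding p_def poly_prod by (rule prod_zero) (use that assms(1) in auto)
    then show ?thesis using assms(1) a by (simp add: sum.remove[of M a])
  qed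
  moreover have "poly p (of_real (\<tau> a)) \<noteq> 0"
    using assms(1,3) a by (auto simp: p_def poly_prod inj_on_def)
  ultimately show ?thesis by simp
qed

lemma bounded_family_convergent_subsequence:
  fixes Z :: "nat \<Rightarrow> 'a \<Rightarrow> 'b :: heine_borel"
  assumes "finite A" and "\<And>a. a \<in> A \<Longrightarrow> bounded (range (\<lambda>k. Z k a))"
  obtains z \<phi> where "strict_mono (\<phi> :: nat \<Rightarrow> nat)" "\<And>a. a \<in> A \<Longrightarrow> (\<lambda>k. Z (\<phi> k) a) \<longlonglongrightarrow> z a"
proof -
  have "\<exists>z \<phi>. strict_mono (\<phi> :: nat \<Rightarrow> nat) \<and> (\<forall>a\<in>A. (\<lambda>k. Z (\<phi> k) a) \<longlonglongrightarrow> z a)"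
    using assms
  proof (induction A rule: finite_induct)
    case empty
    show ?case using strict_mono_id by auto
  next
    case (insert b A)
    then obtain z \<phi> where \<phi>: "strict_mono (\<phi> :: nat \<Rightarrow> nat)" "\<forall>a\<in>A. (\<lambda>k. Z (\<phi> k) a) \<longlonglongrightarrow> z a"
      by auto
    have "bounded (range (\<lambda>k. Z (\<phi> k) b))"
      by (rule bounded_subset[OF insert.prems[of b]]) auto
    then obtain y \<psi> where \<psi>: "strict_mono (\<psi> :: nat \<Rightarrow> nat)" "((\<lambda>k. Z (\<phi> k) b) \<circ> \<psi>) \<longlonglongrightarrow> y"
      using bounded_imp_convergent_subsequence by blast
    have "(\<lambda>k. Z ((\<phi> \<circ> \<psi>) k) a) \<longlonglongrightarrow> (z(b := y)) a" if "a \<in> insert b A" for a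
      using that \<psi>(2) LIMSEQ_subseq_LIMSEQ[OF _ \<psi>(1), of "\<lambda>k. Z (\<phi> k) a" "z a"] \<phi>(2) insert.hyps
      by (auto simp: o_def)
    then show ?case using strict_mono_o[OF \<phi>(1) \<psi>(1)] by blast
  qed
  then show ?thesis using that by blast
qed

subsection \<open>Isolated and finite solution sets\<close>

lemma has_derivative_mono:
  fixes x :: "complex^'n"
  assumes "\<And>i. x $ i \<noteq> 0"
  shows "(mono a has_derivative (\<lambda>h. \<Sum>i\<in>UNIV. of_int (a $ i) * mono a x / x $ i * h $ i)) (at x)"
proof -
  have "((\<lambda>x. \<Prod>i\<in>UNIV. (x $ i) powi (a $ i)) has_derivative
     (\<lambda>h. \<Sum>i\<in>UNIV. h $ i * (of_int (a $ i) * (x $ i) powi (a $ i - 1)) *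
        (\<Prod>j\<in>UNIV - {i}. (x $ j) powi (a $ j)))) (at x)"
    by (intro has_derivative_prod has_derivative_power_int assms bounded_linear_imp_has_derivative
        bounded_linear_vec_nth)
  moreover have "h $ i * (of_int (a $ i) * (x $ i) powi (a $ i - 1)) * (\<Prod>j\<in>UNIV - {i}. (x $ j) powi (a $ j))
      = of_int (a $ i) * mono a x / x $ i * h $ i" for h :: "complex^'n" and i
  proof -
    have "mono a x = (x $ i) powi (a $ i) * (\<Prod>j\<in>UNIV - {i}. (x $ j) powi (a $ j))"
      unfolding mono_def by (rule prod.remove) auto
    then show ?thesis using assms[of i] by (simp add: power_int_diff)
  qed
  ultimately show ?thesis by (simp add: mono_def[abs_def])
qed

text \<open>Identifies the algebraic formula \<open>jac\<close> with the Frechet derivative, so that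
  its determinant controls the local behaviour of the solutions.\<close>

lemma has_derivative_leval:
  fixes x :: "complex^'n"
  assumes "\<And>i. x $ i \<noteq> 0"
  shows "(leval (f j) has_derivative (\<lambda>h. (jac f x *v h) $ j)) (at x)"
proof -
  have "(leval (f j) has_derivative (\<lambda>h. \<Sum>a\<in>{a. f j a \<noteq> 0}. complex_of_real (f j a) *
      (\<Sum>i\<in>UNIV. of_int (a $ i) * mono a x / x $ i * h $ i))) (at x)"
    unfolding leval_def[abs_def]
    by (intro has_derivative_sum has_derivative_mult_right has_derivative_mono assms)
  also have "(\<lambda>h. \<Sum>a\<in>{a. f j a \<noteq> 0}. complex_of_real (f j a) *
      (\<Sum>i\<in>UNIV. of_int (a $ i) * mono a x / x $ i * h $ i)) = (\<lambda>h. (jac f x *v h) $ j)"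
    by (simp add: jac_def matrix_vector_mult_def sum_distrib_left sum_distrib_right
        sum.swap[of _ UNIV] mult.assoc)
  finally show ?thesis .
qed

text \<open>An invertible Jacobian is bounded below by some \<open>B > 0\<close>. At two nearby
  solutions all values vanish, so the image of their difference is the linearisation error, which is
  at most half of that bound.\<close>

lemma nondegenerate_imp_isolated:
  fixes x :: "complex^'n"
  assumes x: "x \<in> torus_sols f" and det: "det (jac f x) \<noteq> 0"
  shows "\<not> x islimpt torus_sols f"
proof
  assume lim: "x islimpt torus_sols f"
  have nz: "x $ i \<noteq> 0" for i using x by (simp add: torus_sols_def)
  let ?L = "(*v) (jac f x)"
  have lin: "linear ?L"
    by (rule linearI, rule matrix_vector_right_distrib)
      (simp add: vec_eq_iff matrix_vector_mult_def scaleR_sum_right)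
  have "inj ?L"
    using det invertible_det_nz invertible_left_inverse matrix_left_invertible_injective by metis
  then obtain B where B: "B > 0" "\<And>h. B * norm h \<le> norm (?L h)"
    using linear_inj_bounded_below_pos[OF lin] by blast
  \<comment> \<open>Each of the \<open>n\<close> components contributes a relative error of at most
    \<open>\<epsilon>\<close>, which adds up to \<open>B / 2\<close>.\<close>
  define \<epsilon> where "\<epsilon> = B / (2 * real CARD('n))"
  have "\<epsilon> > 0" using B by (simp add: \<epsilon>_def)
  then have "\<exists>d>0. \<forall>y. norm (y - x) < d \<longrightarrow>
      norm (leval (f j) y - leval (f j) x - ?L (y - x) $ j) \<le> \<epsilon> * norm (y - x)" for j
    using has_derivative_leval[OF nz, of f j] unfolding has_derivative_at_alt by blast
  then obtain d where d: "\<And>j. d j > 0" "\<And>j y. norm (y - x) < d j \<Longrightarrow>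
      norm (leval (f j) y - leval (f j) x - ?L (y - x) $ j) \<le> \<epsilon> * norm (y - x)"
    by metis
  define \<delta> where "\<delta> = Min (range d)"
  have \<delta>: "\<delta> > 0" "\<And>j. \<delta> \<le> d j" using d(1) by (auto simp: \<delta>_def)
  obtain y where y: "y \<in> torus_sols f" "y \<noteq> x" "dist y x < \<delta>"
    using lim \<delta>(1) by (auto simp: islimpt_approachable)
  have "norm (?L (y - x) $ j) \<le> \<epsilon> * norm (y - x)" for j
    using d(2)[of y j] y \<delta>(2)[of j] x by (force simp: torus_sols_def dist_norm)
  then have "(\<Sum>j\<in>UNIV. norm (?L (y - x) $ j)) \<le> real CARD('n) * (\<epsilon> * norm (y - x))"
    using sum_bounded_above[of UNIV "\<lambda>j. norm (?L (y - x) $ j)" "\<epsilon> * norm (y - x)"] by simp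
  moreover have "norm (?L (y - x)) \<le> (\<Sum>j\<in>UNIV. norm (?L (y - x) $ j))"
    unfolding norm_vec_def by (rule L2_set_le_sum) simp
  ultimately have "B * norm (y - x) \<le> B / 2 * norm (y - x)"
    using B(2)[of "y - x"] by (simp add: \<epsilon>_def)
  then show False using B(1) y by (simp add: field_simps)
qed

definition log_norm :: "complex^'n \<Rightarrow> real^'n" where
  "log_norm x = (\<chi> i. ln (norm (x $ i)))"

text \<open>The bound on \<open>log_norm\<close> keeps the solutions away from zero and infinity, in
  a compact part \<open>K\<close> of the torus. There the solution set is closed, so infinitely many
  solutions would accumulate at a solution, which nondegeneracy forbids.\<close>

lemma finite_torus_sols:
  fixes f :: "'n \<Rightarrow> (int^'n \<Rightarrow> real)"
  assumes det: "\<And>x. x \<in> torus_sols f \<Longrightarrow> det (jac f x) \<noteq> 0"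
    and bounded: "\<And>x. x \<in> torus_sols f \<Longrightarrow> norm (log_norm x) \<le> R"
  shows "finite (torus_sols f)"
proof -
  define K where "K = {x :: complex^'n. \<forall>i. exp (- R) \<le> norm (x $ i) \<and> norm (x $ i) \<le> exp R}"
  have K_nz: "x $ i \<noteq> 0" if "x \<in> K" for x i
    using that by (auto simp: K_def) (metis exp_gt_zero norm_zero not_le)
  have "closed K"
    unfolding K_def by (intro closed_Collect_all closed_Collect_conj closed_Collect_le continuous_intros)
  moreover have "bounded K"
  proof -
    have "norm x \<le> real CARD('n) * exp R" if "x \<in> K" for x
    proof -
      have "norm x \<le> (\<Sum>i\<in>UNIV. norm (x $ i))" unfolding norm_vec_def by (rule L2_set_le_sum) simp
      also have "\<dots> \<le> real CARD('n) * exp R"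
        using sum_bounded_above[of UNIV "\<lambda>i. norm (x $ i)" "exp R"] that by (simp add: K_def)
      finally show ?thesis .
    qed
    then show ?thesis by (auto simp: bounded_iff)
  qed
  ultimately have "compact K" by (simp add: compact_eq_bounded_closed)
  have sub: "torus_sols f \<subseteq> K"
  proof
    fix x assume x: "x \<in> torus_sols f"
    have "\<bar>ln (norm (x $ i))\<bar> \<le> R" for i
      using bounded[OF x] component_le_norm_cart[of "log_norm x" i] by (simp add: log_norm_def)
    moreover have "norm (x $ i) = exp (ln (norm (x $ i)))" for i
      using x by (simp add: torus_sols_def)
    ultimately show "x \<in> K"
      unfolding K_def by (smt (verit) exp_le_cancel_iff mem_Collect_eq)
  qed
  have "continuous_on K (leval (f j))" for j
    using has_derivative_leval[OF K_nz] has_derivative_at_withinI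
    by (intro has_derivative_continuous_on) blast
  then have "closed {x \<in> K. leval (f j) x = 0}" for j
    by (intro continuous_closed_preimage_constant \<open>closed K\<close>)
  moreover have "torus_sols f = (\<Inter>j. {x \<in> K. leval (f j) x = 0})"
    using sub K_nz by (auto simp: torus_sols_def)
  ultimately have "closed (torus_sols f)" by auto
  then have "\<not> x islimpt torus_sols f" for x
    using nondegenerate_imp_isolated det closed_limpt by blast
  then have "finite (K \<inter> torus_sols f)"
    using finite_not_islimpt_in_compact[OF \<open>compact K\<close>] by blast
  then show ?thesis using sub by (simp add: Int_absorb1)
qed

subsection \<open>Complex solutions of the Viro system\<close>

lemma norm_mono:
  fixes x :: "complex^'n"
  assumes "\<And>i. x $ i \<noteq> 0"
  shows "norm (mono a x) = exp (log_norm x \<bullet> real_vec a)"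
proof -
  have "norm (mono a x) = (\<Prod>i\<in>UNIV. norm (x $ i) powi (a $ i))"
    by (simp add: mono_def norm_power_int flip: prod_norm)
  also have "\<dots> = (\<Prod>i\<in>UNIV. exp (log_norm x $ i * real_vec a $ i))"
  proof (rule prod.cong)
    fix i
    have "norm (x $ i) = exp (log_norm x $ i)" using assms by (simp add: log_norm_def)
    then show "norm (x $ i) powi (a $ i) = exp (log_norm x $ i * real_vec a $ i)"
      by (simp add: exp_power_int real_vec_def mult.commute)
  qed simp
  also have "\<dots> = exp (log_norm x \<bullet> real_vec a)"
    by (simp add: inner_vec_def exp_sum)
  finally show ?thesis .
qed

text \<open>Of the triangulation, only the fact that its simplices cover the polytope is retained.
  The numbering \<open>e\<close> of the equations supplies the powers of \<open>\<tau>\<close>, so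
  the coefficients form a Vandermonde matrix with distinct nodes, up to positive factors on the
  columns.\<close>

locale viro_system =
  fixes A :: "(int^'n) set" and w :: "int^'n \<Rightarrow> real" and \<tau> :: "int^'n \<Rightarrow> real" and e :: "'n \<Rightarrow> nat"
  assumes finite_A: "finite A" and A_nonempty: "A \<noteq> {}"
    and inj_\<tau>: "inj_on \<tau> A" and \<tau>_pos: "a \<in> A \<Longrightarrow> \<tau> a > 0"
    and bij_e: "bij_betw e UNIV {..<CARD('n)}"
    and covered: "x \<in> convex hull (real_vec ` A) \<Longrightarrow>
      \<exists>u c. lower_simplex A w u c \<and> x \<in> convex hull (real_vec ` tight A w u c)"
begin

definition coef :: "real \<Rightarrow> 'n \<Rightarrow> int^'n \<Rightarrow> real" where
  "coef T j a = (if a \<in> A then \<tau> a ^ e j * exp (- (T * w a)) else 0)"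

definition wmono :: "real \<Rightarrow> complex^'n \<Rightarrow> int^'n \<Rightarrow> complex" where
  "wmono T x a = complex_of_real (exp (- (T * w a))) * mono a x"

text \<open>Dividing by this sum makes the norms of the terms add up to one, so that along a
  sequence of solutions subsequential limits exist and cannot all vanish.\<close>

definition wsize :: "real \<Rightarrow> complex^'n \<Rightarrow> real" where
  "wsize T x = (\<Sum>a\<in>A. norm (wmono T x a))"

lemma support_coef: "{a. coef T j a \<noteq> 0} = A"
  using \<tau>_pos by (force simp: coef_def)

lemma leval_coef: "leval (coef T j) x = (\<Sum>a\<in>A. of_real (\<tau> a ^ e j) * wmono T x a)"
  unfolding leval_def support_coef by (rule sum.cong) (auto simp: coef_def wmono_def mult.assoc)

text \<open>In the coordinates \<open>v $ i = h $ i / x $ i\<close> the Jacobian is a logarithmic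
  derivative: each weighted monomial is merely multiplied by a linear form in its exponent. A kernel
  vector thus yields a relation of the same shape as the system itself.\<close>

lemma jac_coef:
  "(jac (coef T) x *v (\<chi> i. x $ i * v $ i)) $ j =
    (\<Sum>a\<in>A. of_real (\<tau> a ^ e j) * wmono T x a * (\<Sum>i\<in>UNIV. of_int (a $ i) * v $ i))"
  if "\<And>i. x $ i \<noteq> 0"
proof -
  have "(jac (coef T) x *v (\<chi> i. x $ i * v $ i)) $ j =
     (\<Sum>i\<in>UNIV. \<Sum>a\<in>A. of_real (\<tau> a ^ e j) * wmono T x a * (of_int (a $ i) * v $ i))"
    unfolding jac_def matrix_vector_mult_def support_coef
    by (simp add: sum_distrib_right, intro sum.cong refl)
      (use that in \<open>auto simp: coef_def wmono_def field_simps\<close>)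
  also have "\<dots> = (\<Sum>a\<in>A. \<Sum>i\<in>UNIV. of_real (\<tau> a ^ e j) * wmono T x a * (of_int (a $ i) * v $ i))"
    by (rule sum.swap)
  finally show ?thesis by (simp only: sum_distrib_left)
qed

text \<open>The bijection \<open>e\<close> turns the equations into all powers below
  \<open>n\<close>, so the Vandermonde argument applies. The field is left open because limits of
  terms are complex while the construction at odd cells is real.\<close>

lemma kernel_trivial:
  fixes z :: "int^'n \<Rightarrow> 'k :: real_normed_field"
  assumes "M \<subseteq> A" "card M \<le> CARD('n)" "\<And>j. (\<Sum>a\<in>M. of_real (\<tau> a ^ e j) * z a) = 0" "a \<in> M"
  shows "z a = 0"
proof (rule vandermonde_kernel_trivial[of M "CARD('n)" \<tau> z])
  show "(\<Sum>a\<in>M. of_real (\<tau> a ^ i) * z a) = 0" if "i < CARD('n)" for i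
  proof -
    obtain j where "i = e j"
      using bij_e \<open>i < CARD('n)\<close> by (metis bij_betw_imp_surj_on image_iff lessThan_iff)
    then show ?thesis using assms(3) by simp
  qed
qed (use assms finite_A finite_subset inj_\<tau> inj_on_subset in auto)

lemma norm_wmono:
  assumes "x \<in> torus_sols f"
  shows "norm (wmono T x a) = exp (log_norm x \<bullet> real_vec a - T * w a)"
  using assms by (simp add: wmono_def norm_mult norm_mono torus_sols_def flip: exp_add)

lemma wsize_pos: "x \<in> torus_sols f \<Longrightarrow> wsize T x > 0"
  unfolding wsize_def using A_nonempty finite_A by (intro sum_pos) (auto simp: norm_wmono)

lemma norm_wmono_le_wsize: "a \<in> A \<Longrightarrow> norm (wmono T x a) \<le> wsize T x"
  unfolding wsize_def using finite_A by (intro member_le_sum) auto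

lemma ln_normalized_wmono:
  assumes "x \<in> torus_sols f"
  shows "ln (norm (wmono T x a / of_real (wsize T x)))
    = log_norm x \<bullet> real_vec a - T * w a - ln (wsize T x)"
  using wsize_pos[OF assms, of T] by (simp add: norm_divide norm_wmono[OF assms] ln_div)

text \<open>By the Vandermonde property more than \<open>n\<close> monomials stay comparable to the largest one, and
  the barycenter argument confines them to a single simplex, which they must therefore exhaust.\<close>

lemma solutions_concentrate_on_simplex:
  assumes T: "filterlim T at_top sequentially" and x: "\<And>k. x k \<in> torus_sols (coef (T k))"
  shows "\<exists>\<phi> u c z. strict_mono (\<phi> :: nat \<Rightarrow> nat) \<and> lower_simplex A w u c \<and>
    (\<forall>a\<in>A. (\<lambda>k. wmono (T (\<phi> k)) (x (\<phi> k)) a / of_real (wsize (T (\<phi> k)) (x (\<phi> k)))) \<longlonglongrightarrow> z a) \<and>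
    (\<forall>a\<in>A. z a \<noteq> 0 \<longleftrightarrow> a \<in> tight A w u c)"
proof -
  define Z where "Z k a = wmono (T k) (x k) a / of_real (wsize (T k) (x k))" for k a
  have pos: "wsize (T k) (x k) > 0" for k using wsize_pos x by blast
  have Z_le: "norm (Z k a) \<le> 1" if "a \<in> A" for k a
    using norm_wmono_le_wsize[OF that, of "T k" "x k"] pos[of k] by (simp add: Z_def norm_divide)
  then have "bounded (range (\<lambda>k. Z k a))" if "a \<in> A" for a
    using that by (auto simp: bounded_iff)
  then obtain z \<phi> where \<phi>: "strict_mono (\<phi> :: nat \<Rightarrow> nat)"
      and z: "\<And>a. a \<in> A \<Longrightarrow> (\<lambda>k. Z (\<phi> k) a) \<longlonglongrightarrow> z a"
    using bounded_family_convergent_subsequence[OF finite_A, of Z] by blast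
  have "norm (Z k a) = norm (wmono (T k) (x k) a) / wsize (T k) (x k)" for k a
    using pos[of k] by (simp add: Z_def norm_divide)
  then have "(\<Sum>a\<in>A. norm (Z k a)) = 1" for k
    using pos[of k] by (simp flip: sum_divide_distrib wsize_def)
  moreover have "(\<lambda>k. \<Sum>a\<in>A. norm (Z (\<phi> k) a)) \<longlonglongrightarrow> (\<Sum>a\<in>A. norm (z a))"
    by (intro tendsto_sum tendsto_norm z)
  ultimately have sum_z: "(\<Sum>a\<in>A. norm (z a)) = 1"
    by (simp add: LIMSEQ_const_iff)
  define M where "M = {a\<in>A. z a \<noteq> 0}"
  have M: "M \<subseteq> A" "finite M" using finite_A by (auto simp: M_def)
  have "M \<noteq> {}"
  proof
    assume "M = {}"
    then have "(\<Sum>a\<in>A. norm (z a)) = 0" by (intro sum.neutral) (auto simp: M_def)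
    then show False using sum_z by simp
  qed
  have eq0: "(\<Sum>a\<in>A. of_real (\<tau> a ^ e j) * z a) = 0" for j
  proof -
    have "(\<Sum>a\<in>A. of_real (\<tau> a ^ e j) * Z k a) = 0" for k
    proof -
      have "leval (coef (T k) j) (x k) = 0" using x[of k] by (simp add: torus_sols_def)
      then show ?thesis by (simp add: Z_def leval_coef flip: sum_divide_distrib)
    qed
    moreover have "(\<lambda>k. \<Sum>a\<in>A. of_real (\<tau> a ^ e j) * Z (\<phi> k) a) \<longlonglongrightarrow> (\<Sum>a\<in>A. of_real (\<tau> a ^ e j) * z a)"
      by (intro tendsto_sum tendsto_mult tendsto_const z)
    ultimately show ?thesis by (simp add: LIMSEQ_const_iff)
  qed
  have "card M > CARD('n)"
  proof (rule ccontr)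
    assume le: "\<not> card M > CARD('n)"
    have "(\<Sum>a\<in>M. of_real (\<tau> a ^ e j) * z a) = (\<Sum>a\<in>A. of_real (\<tau> a ^ e j) * z a)" for j
      using finite_A by (intro sum.mono_neutral_left) (auto simp: M_def)
    then have "z a = 0" if "a \<in> M" for a
      using kernel_trivial[OF M(1) _ _ that, of z] le eq0 by simp
    then show False using \<open>M \<noteq> {}\<close> by (auto simp: M_def)
  qed
  have "(\<Sum>a\<in>M. (1 / real (card M)) *\<^sub>R real_vec a) \<in> convex hull (real_vec ` A)"
    using M \<open>M \<noteq> {}\<close> by (intro convex_sum) (auto intro: hull_inc)
  from covered[OF this] obtain u c where uc: "lower_simplex A w u c"
     "(\<Sum>a\<in>M. (1 / real (card M)) *\<^sub>R real_vec a) \<in> convex hull (real_vec ` tight A w u c)" by blast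
  have "M \<subseteq> tight A w u c"
  proof (rule ccontr)
    assume "\<not> M \<subseteq> tight A w u c"
    from barycenter_gap[OF finite_A M(1) \<open>M \<noteq> {}\<close> uc this]
    obtain \<eta> where \<eta>: "\<eta> > 0"
      "\<And>x y z m. \<lbrakk>\<And>a. a \<in> A \<Longrightarrow> x \<bullet> real_vec a - y * w a \<le> z;
       \<And>a. a \<in> M \<Longrightarrow> m \<le> x \<bullet> real_vec a - y * w a\<rbrakk> \<Longrightarrow> m + y * \<eta> \<le> z" by blast
    \<comment> \<open>Half the smallest limiting modulus on \<open>M\<close>: eventually every
      normalised term in \<open>M\<close> exceeds it. The gap then gives
      \<open>T k * \<eta> \<le> - ln \<zeta>\<close>, which fails once \<open>T k\<close> is
      large.\<close>
    define \<zeta> where "\<zeta> = Min ((\<lambda>a. norm (z a)) ` M) / 2"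
    have "Min ((\<lambda>a. norm (z a)) ` M) > 0"
      using M \<open>M \<noteq> {}\<close> by (simp add: M_def)
    moreover have "Min ((\<lambda>a. norm (z a)) ` M) \<le> norm (z a)" if "a \<in> M" for a
      using M that by simp
    ultimately have \<zeta>: "\<zeta> > 0" "\<And>a. a \<in> M \<Longrightarrow> \<zeta> < norm (z a)" unfolding \<zeta>_def by force+
    have "\<forall>a\<in>M. eventually (\<lambda>k. \<zeta> < norm (Z (\<phi> k) a)) sequentially"
      by (intro ballI order_tendstoD(1)[OF tendsto_norm[OF z]] \<zeta>(2)) (use M(1) in auto)
    then have "eventually (\<lambda>k. \<forall>a\<in>M. \<zeta> < norm (Z (\<phi> k) a)) sequentially"
      using M(2) by (intro eventually_ball_finite) auto
    moreover have "eventually (\<lambda>k. T (\<phi> k) > - ln \<zeta> / \<eta>) sequentially"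
      using filterlim_compose[OF T filterlim_subseq[OF \<phi>]] by (simp add: filterlim_at_top_dense)
    ultimately have "eventually (\<lambda>k. (\<forall>a\<in>M. \<zeta> < norm (Z (\<phi> k) a)) \<and> T (\<phi> k) > - ln \<zeta> / \<eta>) sequentially"
      by (rule eventually_conj)
    then obtain k0 where "(\<forall>a\<in>M. \<zeta> < norm (Z (\<phi> k0) a)) \<and> T (\<phi> k0) > - ln \<zeta> / \<eta>"
      using eventually_happens trivial_limit_sequentially by blast
    then obtain k where k: "\<And>a. a \<in> M \<Longrightarrow> \<zeta> < norm (Z k a)" "T k > - ln \<zeta> / \<eta>"
      by blast
    let ?m = "ln (wsize (T k) (x k))"
    have "ln (norm (Z k a)) = log_norm (x k) \<bullet> real_vec a - T k * w a - ?m" for a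
      unfolding Z_def using ln_normalized_wmono x by blast
    then have lnZ: "log_norm (x k) \<bullet> real_vec a - T k * w a = ?m + ln (norm (Z k a))" for a
      by simp
    have "Z k a \<noteq> 0" for a
      using pos[of k] norm_wmono[OF x[of k], of "T k" a] by (auto simp: Z_def)
    then have "ln (norm (Z k a)) \<le> 0" if "a \<in> A" for a
      using Z_le[OF that, of k] by simp
    moreover have "ln (norm (Z k a)) \<ge> ln \<zeta>" if "a \<in> M" for a
      using k(1)[OF that] \<zeta>(1) by (subst ln_le_cancel_iff) auto
    ultimately have "(?m + ln \<zeta>) + T k * \<eta> \<le> ?m"
      by (intro \<eta>(2)[of "log_norm (x k)" "T k"]) (auto simp: lnZ)
    moreover have "T k * \<eta> > - ln \<zeta>" using k(2) unfolding pos_divide_less_eq[OF \<eta>(1)] .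
    ultimately show False by simp
  qed
  moreover have "card (tight A w u c) \<le> card M"
    using uc(1) \<open>card M > CARD('n)\<close> by (simp add: lower_simplex_def)
  moreover have "finite (tight A w u c)" using finite_A by (simp add: tight_def)
  ultimately have "M = tight A w u c" by (intro card_seteq)
  then have "z a \<noteq> 0 \<longleftrightarrow> a \<in> tight A w u c" if "a \<in> A" for a
    using that by (auto simp: M_def)
  then show ?thesis
    using \<phi> uc(1) z unfolding Z_def by (intro exI[of _ \<phi>] exI[of _ u] exI[of _ c] exI[of _ z]) blast
qed

section \<open>Nondegeneracy and boundedness of the solutions for large \<open>T\<close>\<close>

text \<open>For degenerate solutions with \<open>T\<close> tending to infinity, take unit kernel
  vectors in logarithmic coordinates and pass to the limit. The system and the kernel relation then
  both live on one simplex; eliminating one vertex leaves \<open>n\<close> columns. Their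
  independence makes the linear form of the limit vector constant on the vertices, so the vector is
  zero.\<close>

lemma eventually_nondegenerate:
  "\<exists>T0. \<forall>T\<ge>T0. \<forall>x\<in>torus_sols (coef T). det (jac (coef T) x) \<noteq> 0"
proof (rule ccontr)
  assume "\<not> ?thesis"
  then have "\<exists>T x. T \<ge> real k \<and> x \<in> torus_sols (coef T) \<and> det (jac (coef T) x) = 0" for k
    by blast
  then obtain T x where Tx: "\<And>k. T k \<ge> real k" "\<And>k. x k \<in> torus_sols (coef (T k))"
      "\<And>k. det (jac (coef (T k)) (x k)) = 0" by metis
  have T: "filterlim T at_top sequentially"
    by (rule filterlim_at_top_mono[OF filterlim_real_sequentially]) (simp add: Tx(1))
  obtain \<phi> u c z where \<phi>: "strict_mono (\<phi> :: nat \<Rightarrow> nat)" and uc: "lower_simplex A w u c" and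
    lim: "\<forall>a\<in>A. (\<lambda>k. wmono (T (\<phi> k)) (x (\<phi> k)) a / of_real (wsize (T (\<phi> k)) (x (\<phi> k)))) \<longlonglongrightarrow> z a" and
    supp: "\<forall>a\<in>A. z a \<noteq> 0 \<longleftrightarrow> a \<in> tight A w u c"
    using solutions_concentrate_on_simplex[OF T Tx(2)] by (elim exE conjE)
  note z = lim[rule_format] supp[rule_format]
  let ?p = "\<lambda>a v :: complex^'n. \<Sum>i\<in>UNIV. of_int (a $ i) * v $ i"
  have "\<forall>k. \<exists>v. norm v = 1 \<and> (\<forall>j. (\<Sum>a\<in>A. of_real (\<tau> a ^ e j) * wmono (T k) (x k) a * ?p a v) = 0)"
  proof
    fix k
    have nz: "x k $ i \<noteq> 0" for i using Tx(2)[of k] by (simp add: torus_sols_def)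
    obtain h where h: "h \<noteq> 0" "jac (coef (T k)) (x k) *v h = 0"
    proof -
      have "\<not> invertible (jac (coef (T k)) (x k))" using Tx(3)[of k] by (simp add: invertible_det_nz)
      then have "\<not> (\<forall>h. jac (coef (T k)) (x k) *v h = 0 \<longrightarrow> h = 0)"
        unfolding invertible_left_inverse matrix_left_invertible_ker .
      then show ?thesis using that by blast
    qed
    define v where "v = (\<chi> i. h $ i / x k $ i)"
    have hv: "h = (\<chi> i. x k $ i * v $ i)" using nz by (simp add: v_def vec_eq_iff)
    have "v \<noteq> 0"
    proof
      assume "v = 0"
      then show False using h(1) unfolding hv by (simp add: vec_eq_iff)
    qed
    have *: "(\<Sum>a\<in>A. of_real (\<tau> a ^ e j) * wmono (T k) (x k) a * ?p a v) = 0" for j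
      using h(2) unfolding hv jac_coef[OF nz, symmetric] by simp
    have p: "?p a ((1 / norm v) *\<^sub>R v) = ?p a v / of_real (norm v)" for a
      unfolding sum_divide_distrib vector_scaleR_component scaleR_conv_of_real[where 'a = complex]
      by (rule sum.cong) simp_all
    have "(\<Sum>a\<in>A. of_real (\<tau> a ^ e j) * wmono (T k) (x k) a * ?p a ((1 / norm v) *\<^sub>R v)) = 0" for j
      unfolding p times_divide_eq_right sum_divide_distrib[symmetric] * by simp
    moreover have "norm ((1 / norm v) *\<^sub>R v) = 1" using \<open>v \<noteq> 0\<close> by simp
    ultimately show "\<exists>v. norm v = 1 \<and>
        (\<forall>j. (\<Sum>a\<in>A. of_real (\<tau> a ^ e j) * wmono (T k) (x k) a * ?p a v) = 0)"
      by (intro exI[of _ "(1 / norm v) *\<^sub>R v"] conjI allI)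
  qed
  from choice[OF this] obtain v where v': "\<forall>k. norm (v k) = 1 \<and>
      (\<forall>j. (\<Sum>a\<in>A. of_real (\<tau> a ^ e j) * wmono (T k) (x k) a * ?p a (v k)) = 0)" by (elim exE)
  note v = v'[THEN spec, THEN conjunct1] v'[THEN spec, THEN conjunct2, THEN spec]
  have "bounded (range (v \<circ> \<phi>))" using v(1) by (auto simp: bounded_iff)
  then obtain v0 \<psi> where \<psi>: "strict_mono (\<psi> :: nat \<Rightarrow> nat)" and v0: "((v \<circ> \<phi>) \<circ> \<psi>) \<longlonglongrightarrow> v0"
    using bounded_imp_convergent_subsequence by blast
  have "(\<lambda>k. norm (((v \<circ> \<phi>) \<circ> \<psi>) k)) \<longlonglongrightarrow> norm v0" by (intro tendsto_norm v0)
  then have norm_v0: "norm v0 = 1" by (simp add: v(1) LIMSEQ_const_iff)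
  define Z where "Z k a = wmono (T k) (x k) a / of_real (wsize (T k) (x k))" for k a
  have lim_Z: "(\<lambda>k. Z (\<phi> (\<psi> k)) a) \<longlonglongrightarrow> z a" if "a \<in> A" for a
    using LIMSEQ_subseq_LIMSEQ[OF z(1)[OF that] \<psi>] by (simp add: Z_def o_def)
  have lim_eq: "(\<Sum>a\<in>A. of_real (\<tau> a ^ e j) * z a * y a) = 0"
    if "\<And>a. a \<in> A \<Longrightarrow> (\<lambda>k. Y k a) \<longlonglongrightarrow> y a" "\<And>k. (\<Sum>a\<in>A. of_real (\<tau> a ^ e j) * Z (\<phi> (\<psi> k)) a * Y k a) = 0"
    for Y y j
  proof -
    have "(\<lambda>k. \<Sum>a\<in>A. of_real (\<tau> a ^ e j) * Z (\<phi> (\<psi> k)) a * Y k a) \<longlonglongrightarrow>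
      (\<Sum>a\<in>A. of_real (\<tau> a ^ e j) * z a * y a)"
      by (intro tendsto_sum tendsto_mult tendsto_const lim_Z that(1))
    then show ?thesis unfolding that(2) by (simp add: LIMSEQ_const_iff)
  qed
  have eq1: "(\<Sum>a\<in>A. of_real (\<tau> a ^ e j) * z a * ?p a v0) = 0" for j
  proof (rule lim_eq)
    show "(\<lambda>k. ?p a (((v \<circ> \<phi>) \<circ> \<psi>) k)) \<longlonglongrightarrow> ?p a v0" for a
      by (intro tendsto_sum tendsto_mult tendsto_const tendsto_vec_nth v0)
    show "(\<Sum>a\<in>A. of_real (\<tau> a ^ e j) * Z (\<phi> (\<psi> k)) a * ?p a (((v \<circ> \<phi>) \<circ> \<psi>) k)) = 0" for k
      using v(2)[of j "\<phi> (\<psi> k)"] by (simp add: Z_def flip: sum_divide_distrib)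
  qed
  have eq2: "(\<Sum>a\<in>A. of_real (\<tau> a ^ e j) * z a * 1) = 0" for j
  proof (rule lim_eq)
    show "(\<Sum>a\<in>A. of_real (\<tau> a ^ e j) * Z (\<phi> (\<psi> k)) a * 1) = 0" for k
      using Tx(2)[of "\<phi> (\<psi> k)"] by (simp add: Z_def torus_sols_def leval_coef flip: sum_divide_distrib)
  qed simp
  define S where "S = tight A w u c"
  have S: "S \<subseteq> A" "finite S" "card S = CARD('n) + 1"
    using uc finite_A by (auto simp: S_def lower_simplex_def tight_def)
  obtain a0 where a0: "a0 \<in> S" using S(3) by fastforce
  have distr: "(\<Sum>a\<in>A. t a * (z a * (p a - q))) = (\<Sum>a\<in>A. t a * z a * p a) - (\<Sum>a\<in>A. t a * z a * 1) * q"
    for t p and q :: complex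
    by (simp add: right_diff_distrib sum_subtractf sum_distrib_right mult.assoc)
  \<comment> \<open>Subtracting the limiting system times the value at \<open>a0\<close> removes
    that vertex, so that only the \<open>n\<close> columns of \<open>S - {a0}\<close>
    remain.\<close>
  define q where "q a = ?p a v0 - ?p a0 v0" for a
  have q0: "q a0 = 0" by (simp add: q_def)
  have eq3: "(\<Sum>a\<in>S - {a0}. of_real (\<tau> a ^ e j) * (z a * q a)) = 0" for j
  proof -
    have "z a * q a = 0" if "a \<in> A - (S - {a0})" for a
      using that z(2)[of a] q0 by (cases "a = a0") (auto simp: S_def)
    then have "(\<Sum>a\<in>S - {a0}. of_real (\<tau> a ^ e j) * (z a * q a)) = (\<Sum>a\<in>A. of_real (\<tau> a ^ e j) * (z a * q a))"
      using S(1) finite_A by (intro sum.mono_neutral_left) auto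
    also have "\<dots> = (\<Sum>a\<in>A. of_real (\<tau> a ^ e j) * z a * ?p a v0)
        - (\<Sum>a\<in>A. of_real (\<tau> a ^ e j) * z a * 1) * ?p a0 v0"
      unfolding q_def by (rule distr)
    finally show ?thesis unfolding eq1 eq2 by simp
  qed
  have const: "?p a v0 = ?p a0 v0" if a: "a \<in> S" for a
  proof (cases "a = a0")
    case False
    have "z a * q a = 0"
    proof (rule kernel_trivial[of "S - {a0}" "\<lambda>a. z a * q a"])
      show "(\<Sum>a\<in>S - {a0}. of_real (\<tau> a ^ e j) * (z a * q a)) = 0" for j by (rule eq3)
    qed (use S a0 a False in auto)
    moreover have "z a \<noteq> 0" using z(2) a S(1) by (auto simp: S_def)
    ultimately show ?thesis by (simp add: q_def)
  qed simp
  \<comment> \<open>The spanning lemma is real, so the complex limit vector is handled through its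
    real and imaginary parts.\<close>
  have ReIm: "(\<chi> i. Re (v0 $ i)) \<bullet> real_vec a = Re (?p a v0)" "(\<chi> i. Im (v0 $ i)) \<bullet> real_vec a = Im (?p a v0)" for a
    by (simp_all add: inner_vec_def real_vec_def mult.commute)
  have "(\<chi> i. Re (v0 $ i)) = 0"
    by (rule lower_simplex_spanning[OF uc]) (unfold ReIm, rule arg_cong[OF const], simp add: S_def)
  moreover have "(\<chi> i. Im (v0 $ i)) = 0"
    by (rule lower_simplex_spanning[OF uc]) (unfold ReIm, rule arg_cong[OF const], simp add: S_def)
  ultimately have "v0 = 0" by (simp add: vec_eq_iff complex_eq_iff)
  then show False using norm_v0 by simp
qed

text \<open>Otherwise there are solutions whose \<open>log_norm\<close> outgrows both 1 and
  \<open>T\<close>. On the limiting simplex the terms stay comparable, so after division by the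
  length of \<open>log_norm\<close> the limit direction has the same inner product with all
  vertices. It must then vanish, although it is a unit vector.\<close>

lemma eventually_bounded_log:
  "\<exists>T0. \<forall>T\<ge>T0. \<exists>R. \<forall>x\<in>torus_sols (coef T). norm (log_norm x) \<le> R"
proof (rule ccontr)
  assume "\<not> ?thesis"
  \<comment> \<open>With \<open>R\<close> taken this large, both \<open>1 / N k\<close> and
    \<open>T k / N k\<close> will tend to zero.\<close>
  then have "\<exists>T x. T \<ge> real k \<and> x \<in> torus_sols (coef T) \<and> norm (log_norm x) > (real k + 1) * (\<bar>T\<bar> + 1)" for k
    by (meson not_le)
  then obtain T x where Tx: "\<And>k. T k \<ge> real k" "\<And>k. x k \<in> torus_sols (coef (T k))"
      "\<And>k. norm (log_norm (x k)) > (real k + 1) * (\<bar>T k\<bar> + 1)" by metis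
  have T: "filterlim T at_top sequentially"
    by (rule filterlim_at_top_mono[OF filterlim_real_sequentially]) (simp add: Tx(1))
  obtain \<phi> u c z where \<phi>: "strict_mono (\<phi> :: nat \<Rightarrow> nat)" and uc: "lower_simplex A w u c" and
    lim: "\<forall>a\<in>A. (\<lambda>k. wmono (T (\<phi> k)) (x (\<phi> k)) a / of_real (wsize (T (\<phi> k)) (x (\<phi> k)))) \<longlonglongrightarrow> z a" and
    supp: "\<forall>a\<in>A. z a \<noteq> 0 \<longleftrightarrow> a \<in> tight A w u c"
    using solutions_concentrate_on_simplex[OF T Tx(2)] by (elim exE conjE)
  note z = lim[rule_format] supp[rule_format]
  define N where "N k = norm (log_norm (x k))" for k
  define \<theta> where "\<theta> k = (1 / N k) *\<^sub>R log_norm (x k)" for k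
  have N: "N k > real k" "N k > real k * \<bar>T k\<bar>" "N k > 0" for k
  proof -
    have *: "(real k + 1) * (\<bar>T k\<bar> + 1) = real k * \<bar>T k\<bar> + real k + \<bar>T k\<bar> + 1"
      by (simp add: algebra_simps)
    have "real k * \<bar>T k\<bar> \<ge> 0" by simp
    then show "N k > real k" "N k > real k * \<bar>T k\<bar>" "N k > 0"
      using Tx(3)[of k, folded N_def] unfolding * by linarith+
  qed
  then have norm_\<theta>: "norm (\<theta> k) = 1" for k by (simp add: \<theta>_def N_def)
  then have "bounded (range (\<theta> \<circ> \<phi>))" by (auto simp: bounded_iff)
  then obtain \<theta>0 \<psi> where \<psi>: "strict_mono (\<psi> :: nat \<Rightarrow> nat)" and \<theta>0: "((\<theta> \<circ> \<phi>) \<circ> \<psi>) \<longlonglongrightarrow> \<theta>0"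
    using bounded_imp_convergent_subsequence by blast
  define \<sigma> where "\<sigma> k = \<phi> (\<psi> k)" for k
  have \<sigma>: "filterlim \<sigma> sequentially sequentially"
    using filterlim_subseq[OF strict_mono_o[OF \<phi> \<psi>]] by (simp add: \<sigma>_def[abs_def] o_def)
  have \<theta>: "(\<lambda>k. \<theta> (\<sigma> k)) \<longlonglongrightarrow> \<theta>0" using \<theta>0 by (simp add: \<sigma>_def o_def)
  have "(\<lambda>k. norm (\<theta> (\<sigma> k))) \<longlonglongrightarrow> norm \<theta>0" by (intro tendsto_norm \<theta>)
  then have "norm \<theta>0 = 1" by (simp add: norm_\<theta> LIMSEQ_const_iff)
  have invN: "(\<lambda>k. 1 / N k) \<longlonglongrightarrow> 0"
  proof -
    have "filterlim N at_top sequentially"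
      by (rule filterlim_at_top_mono[OF filterlim_real_sequentially]) (intro always_eventually allI less_imp_le N)
    then show ?thesis by (rule tendsto_divide_0[OF tendsto_const filterlim_at_top_imp_at_infinity])
  qed
  have TN: "(\<lambda>k. T k / N k) \<longlonglongrightarrow> 0"
  proof (rule Lim_null_comparison)
    show "eventually (\<lambda>k. norm (T k / N k) \<le> 1 / real k) sequentially"
      using eventually_gt_at_top[of 0]
    proof eventually_elim
      case (elim k)
      then show ?case using N[of k] by (simp add: field_simps)
    qed
    show "(\<lambda>k. 1 / real k) \<longlonglongrightarrow> 0" by (rule lim_1_over_n)
  qed
  define S where "S = tight A w u c"
  have S: "S \<subseteq> A" "card S = CARD('n) + 1"
    using uc by (auto simp: S_def lower_simplex_def tight_def)
  obtain a0 where a0: "a0 \<in> S" using S(2) by fastforce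
  have "\<theta>0 \<bullet> real_vec a = \<theta>0 \<bullet> real_vec a0" if "a \<in> S" for a
  proof -
    define l where "l k a = ln (norm (wmono (T k) (x k) a / of_real (wsize (T k) (x k))))" for k a
    have lim_l: "(\<lambda>k. l (\<sigma> k) a) \<longlonglongrightarrow> ln (norm (z a))" if "a \<in> S" for a
      using LIMSEQ_subseq_LIMSEQ[OF z(1) \<psi>, of a] z(2)[of a] that S(1) unfolding l_def \<sigma>_def
      by (intro tendsto_ln tendsto_norm) (auto simp: o_def S_def)
    \<comment> \<open>Comparing with \<open>a0\<close> cancels the normaliser; the logarithms that
      remain converge because the limits \<open>z\<close> are nonzero on \<open>S\<close>.\<close>
    have l: "(l k a - l k a0) * (1 / N k) + T k / N k * (w a - w a0) = \<theta> k \<bullet> real_vec a - \<theta> k \<bullet> real_vec a0" for k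
      unfolding l_def ln_normalized_wmono[OF Tx(2)] \<theta>_def using N(3)[of k] by (simp add: field_simps)
    have "(\<lambda>k. (l (\<sigma> k) a - l (\<sigma> k) a0) * (1 / N (\<sigma> k)) + T (\<sigma> k) / N (\<sigma> k) * (w a - w a0))
      \<longlonglongrightarrow> (ln (norm (z a)) - ln (norm (z a0))) * 0 + 0 * (w a - w a0)"
      by (intro tendsto_intros lim_l that a0 filterlim_compose[OF invN \<sigma>] filterlim_compose[OF TN \<sigma>])
    moreover have "(\<lambda>k. \<theta> (\<sigma> k) \<bullet> real_vec a - \<theta> (\<sigma> k) \<bullet> real_vec a0) \<longlonglongrightarrow>
        \<theta>0 \<bullet> real_vec a - \<theta>0 \<bullet> real_vec a0"
      by (intro tendsto_intros \<theta>)
    ultimately show ?thesis unfolding l using LIMSEQ_unique by fastforce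
  qed
  then have "\<theta>0 = 0" unfolding S_def by (rule lower_simplex_spanning[OF uc])
  then show False using \<open>norm \<theta>0 = 1\<close> by simp
qed

lemma admissible_coef:
  "\<exists>T0. \<forall>T\<ge>T0. admissible_system (convex hull (real_vec ` A)) (coef T)"
proof -
  obtain T1 T2 where T: "\<And>T x. T \<ge> T1 \<Longrightarrow> x \<in> torus_sols (coef T) \<Longrightarrow> det (jac (coef T) x) \<noteq> 0"
      "\<And>T. T \<ge> T2 \<Longrightarrow> \<exists>R. \<forall>x\<in>torus_sols (coef T). norm (log_norm x) \<le> R"
    using eventually_nondegenerate eventually_bounded_log by metis
  have "admissible_system (convex hull (real_vec ` A)) (coef T)" if T_ge: "T \<ge> max T1 T2" for T
  proof -
    obtain R where "\<And>x. x \<in> torus_sols (coef T) \<Longrightarrow> norm (log_norm x) \<le> R"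
      using T(2)[of T] T_ge by auto
    moreover have "\<And>x. x \<in> torus_sols (coef T) \<Longrightarrow> det (jac (coef T) x) \<noteq> 0"
      using T(1) T_ge by auto
    ultimately show ?thesis
      using finite_torus_sols[of "coef T" R] finite_A
      by (simp add: admissible_system_def laurent_poly_def newton_def support_coef)
  qed
  then show ?thesis by blast
qed

end

subsection \<open>Real solutions at odd cells\<close>

text \<open>Applied over two rings: modulo 2 for solving the sign conditions, and over the reals for
  recovering the logarithms of the moduli.\<close>

lemma det_of_int:
  fixes M :: "int^'n^'n"
  shows "det (\<chi> i j. of_int (M $ i $ j)) = (of_int (det M) :: 'k :: comm_ring_1)"
  by (simp add: det_def)

text \<open>The sign conditions form a linear system over the field with two elements, which is
  solvable because the determinant is odd.\<close>

lemma sign_vector_exists: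
  fixes m :: "'n \<Rightarrow> int^'n" and \<sigma> :: "'n \<Rightarrow> real"
  assumes odd: "odd (det (\<chi> j i. m j $ i))" and \<sigma>: "\<And>j. \<sigma> j = 1 \<or> \<sigma> j = -1"
  obtains s :: "real^'n" where "\<And>i. s $ i = 1 \<or> s $ i = -1"
    "\<And>j. (\<Prod>i\<in>UNIV. (s $ i) powi (m j $ i)) = \<sigma> j"
proof -
  \<comment> \<open>The isomorphism from the additive group of two elements to the signs turns the
    multiplicative conditions into linear equations.\<close>
  define sg :: "bit \<Rightarrow> real" where "sg b = (if b = 0 then 1 else -1)" for b
  have sg_add: "sg (x + y) = sg x * sg y" for x y
    by (cases x; cases y) (auto simp: sg_def)
  have sg_sum: "sg (\<Sum>i\<in>I. f i) = (\<Prod>i\<in>I. sg (f i))" for I :: "'n set" and f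
    by (induction I rule: infinite_finite_induct) (auto simp: sg_add, simp_all add: sg_def)
  have of_int_bit: "(of_int k :: bit) = (if even k then 0 else 1)" for k
    by (cases "even k") (auto elim!: evenE oddE)
  have sg_pow: "sg (of_int k * b) = sg b powi k" for k b
  proof (cases "even k")
    case True
    then obtain l where "k = 2 * l" by (elim evenE)
    then show ?thesis
      by (cases b) (auto simp: sg_def power_int_mult of_int_bit)
  next
    case False
    then obtain l where "k = 2 * l + 1" by (elim oddE)
    then show ?thesis
      by (cases b) (auto simp: sg_def power_int_mult power_int_add of_int_bit)
  qed
  define B :: "bit^'n^'n" where "B = (\<chi> j i. of_int ((\<chi> j i. m j $ i) $ j $ i))"
  have "det B = of_int (det (\<chi> j i. m j $ i))" unfolding B_def by (rule det_of_int)
  then have "det B \<noteq> 0" using odd by (simp add: of_int_bit)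
  then obtain B' where "B ** B' = mat 1" by (metis invertible_det_nz invertible_def)
  then have sol: "B *v (B' *v y) = y" for y
    by (simp add: matrix_vector_mul_assoc)
  define b where "b = B' *v (\<chi> j. if \<sigma> j = 1 then 0 else 1)"
  define s :: "real^'n" where "s = (\<chi> i. sg (b $ i))"
  have "(\<Prod>i\<in>UNIV. (s $ i) powi (m j $ i)) = \<sigma> j" for j
  proof -
    have "(B *v b) $ j = (\<Sum>i\<in>UNIV. of_int (m j $ i) * b $ i)"
      by (simp add: matrix_vector_mult_def B_def)
    then have "(\<Prod>i\<in>UNIV. (s $ i) powi (m j $ i)) = sg ((B *v b) $ j)"
      by (simp only: sg_sum sg_pow s_def vec_lambda_beta)
    also have "(B *v b) $ j = (if \<sigma> j = 1 then 0 else 1)" by (simp add: b_def sol)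
    finally show ?thesis using \<sigma>[of j] by (auto simp: sg_def)
  qed
  moreover have "s $ i = 1 \<or> s $ i = -1" for i by (simp add: s_def sg_def)
  ultimately show ?thesis using that by blast
qed

lemma exp_decay: "((\<lambda>T. exp (K - T * \<gamma>)) \<longlongrightarrow> 0) at_top" if "\<gamma> > 0" for K \<gamma> :: real
proof -
  have "filterlim (\<lambda>T. - K + \<gamma> * T) at_top at_top"
    by (intro filterlim_tendsto_add_at_top[OF tendsto_const]
        filterlim_tendsto_pos_mult_at_top[OF tendsto_const that filterlim_ident])
  then have "filterlim (\<lambda>T. - (- K + \<gamma> * T)) at_bot at_top"
    by (simp add: filterlim_uminus_at_top)
  from filterlim_compose[OF exp_at_bot this] show ?thesis by (simp add: mult.commute)
qed

context viro_system
begin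

text \<open>The terms outside the cell are exponentially small in \<open>T\<close>. Treating their
  sum as a perturbation, the system is solved for the terms at \<open>g i\<close> relative to the
  one at \<open>v0\<close>, and their moduli then determine a new \<open>\<eta>\<close>; this gives
  a self-map of a ball, whose fixed point is a solution. The bound \<open>K\<close> does not depend
  on \<open>T\<close>, which later separates the cells.\<close>

lemma odd_simplex_real_solution:
  assumes ls: "lower_simplex A w u c"
    and S_eq: "tight A w u c = insert v0 (range g)"
    and odd: "odd (det (\<chi> i j. (g j - v0) $ i))"
  shows "\<exists>K T0. \<forall>T\<ge>T0. \<exists>x\<in>real_sols (coef T). norm (log_norm x + T *\<^sub>R u) \<le> K"
proof -
  define S where "S = tight A w u c"
  have S: "S \<subseteq> A" "finite S" "card S = CARD('n) + 1" "S = insert v0 (range g)"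
    using ls finite_A S_eq by (auto simp: S_def lower_simplex_def tight_def)
  have "card (range g) \<le> CARD('n)" by (rule card_image_le) simp
  moreover have "card S \<le> Suc (card (range g))" using S(4) by (simp add: card_insert_if)
  ultimately have card_g: "card (range g) = CARD('n)" using S(3) by simp
  then have inj_g: "inj g" by (intro eq_card_imp_inj_on) auto
  have v0: "v0 \<notin> range g" using S card_g by (auto simp: insert_absorb)
  define col where "col b = (\<chi> j. \<tau> b ^ e j)" for b
  define C :: "real^'n^'n" where "C = (\<chi> j i. \<tau> (g i) ^ e j)"
  have sum_g: "(\<Sum>a\<in>range g. \<tau> a ^ e j * (y $ inv g a)) = (C *v y) $ j" for y j
    by (simp add: sum.reindex[OF inj_g] C_def matrix_vector_mult_def inj_g)
  have "y = 0" if "C *v y = 0" for y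
  proof -
    have "y $ inv g a = 0" if "a \<in> range g" for a
      using kernel_trivial[of "range g" "\<lambda>a. y $ inv g a" a] that card_g S sum_g[of _ y] \<open>C *v y = 0\<close>
      by auto
    then have "y $ i = 0" for i using inj_g by (metis inv_f_f rangeI)
    then show ?thesis by (simp add: vec_eq_iff)
  qed
  then obtain B where "B ** C = mat 1" using matrix_left_invertible_ker by blast
  then have "C ** B = mat 1" by (simp add: matrix_left_right_inverse)
  then have CB: "C *v (B *v y) = y" for y by (simp add: matrix_vector_mul_assoc)
  have mult_minus: "M *v (- y) = - (M *v y)" for M :: "real^'n^'n" and y
    by (simp add: vec_eq_iff matrix_vector_mult_def sum_negf)
  \<comment> \<open>The values at the vertices \<open>g i\<close> that solve the system restricted
    to the cell when the value at \<open>v0\<close> is 1. If one of them were zero, \<open>n\<close>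
    columns would be dependent.\<close>
  define r where "r = - (B *v col v0)"
  have r_nz: "r $ i \<noteq> 0" for i
  proof
    assume "r $ i = 0"
    define z where "z a = (if a = v0 then 1 else r $ inv g a)" for a
    have zg: "z (g i) = r $ i" for i using v0 inj_g by (auto simp: z_def)
    have eq: "(\<Sum>a\<in>S - {g i}. \<tau> a ^ e j * z a) = 0" for j
    proof -
      have "(\<Sum>a\<in>S - {g i}. \<tau> a ^ e j * z a) = (\<Sum>a\<in>S. \<tau> a ^ e j * z a)"
        using S(2) \<open>r $ i = 0\<close> zg by (intro sum.mono_neutral_left) auto
      also have "(\<Sum>a\<in>S. \<tau> a ^ e j * z a) = \<tau> v0 ^ e j + (\<Sum>a\<in>range g. \<tau> a ^ e j * z a)"
        unfolding S(4) using v0 by (simp add: z_def)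
      also have "(\<Sum>a\<in>range g. \<tau> a ^ e j * z a) = (\<Sum>a\<in>range g. \<tau> a ^ e j * (r $ inv g a))"
        using v0 by (intro sum.cong) (auto simp: z_def)
      also have "\<tau> v0 ^ e j + (\<Sum>a\<in>range g. \<tau> a ^ e j * (r $ inv g a)) = 0"
        unfolding sum_g r_def by (simp add: mult_minus CB col_def)
      finally show ?thesis .
    qed
    have "z v0 = 0"
    proof (rule kernel_trivial)
      show "(\<Sum>a\<in>S - {g i}. of_real (\<tau> a ^ e j) * z a) = 0" for j using eq by simp
    qed (use S v0 in auto)
    then show False by (simp add: z_def)
  qed
  have "(\<chi> j i. (g j - v0) $ i) = transpose (\<chi> i j. (g j - v0) $ i)"
    by (simp add: transpose_def)
  then have odd': "odd (det (\<chi> j i. (g j - v0) $ i))" using odd by (metis det_transpose)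
  have "sgn (r $ j) = 1 \<or> sgn (r $ j) = - 1" for j using r_nz by (auto simp: sgn_if)
  from sign_vector_exists[of "\<lambda>i. g i - v0" "\<lambda>i. sgn (r $ i)", OF odd' this]
  obtain s :: "real^'n" where s: "\<And>i. s $ i = 1 \<or> s $ i = -1"
    "\<And>i. (\<Prod>k\<in>UNIV. (s $ k) powi ((g i - v0) $ k)) = sgn (r $ i)" by metis
  define spow where "spow a = (\<Prod>k\<in>UNIV. (s $ k) powi (a $ k))" for a :: "int^'n"
  have s_nz: "s $ i \<noteq> 0" for i using s(1)[of i] by auto
  have spow_nz: "spow a \<noteq> 0" for a using s_nz by (simp add: spow_def)
  have spow_diff: "spow (a - b) = spow a / spow b" for a b
    using s_nz by (simp add: spow_def power_int_diff prod_dividef)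
  define N :: "real^'n^'n" where "N = (\<chi> i k. of_int ((\<chi> i k. (g i - v0) $ k) $ i $ k))"
  have N_mult: "(N *v \<eta>) $ i = \<eta> \<bullet> real_vec (g i - v0)" for \<eta> i
    by (simp add: N_def matrix_vector_mult_def inner_vec_def real_vec_def mult.commute)
  have "det N \<noteq> 0"
  proof -
    have "(\<chi> i k. (g i - v0) $ k) = transpose (\<chi> i j. (g j - v0) $ i)"
      by (simp add: transpose_def)
    then show ?thesis unfolding N_def det_of_int using odd by (metis det_transpose even_zero of_int_eq_0_iff)
  qed
  then obtain N' where "N ** N' = mat 1" by (metis invertible_det_nz invertible_def)
  then have NN': "N *v (N' *v y) = y" for y by (simp add: matrix_vector_mul_assoc)
  \<comment> \<open>Height of a lifted exponent above the supporting hyperplane of the cell. It is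
    positive outside the cell and is the exponential rate at which the term there decays.\<close>
  define \<gamma> where "\<gamma> b = u \<bullet> real_vec b + w b - c" for b
  have \<gamma>_pos: "\<gamma> b > 0" if "b \<in> A - S" for b
    using that ls by (force simp: \<gamma>_def S_def tight_def lower_simplex_def order.strict_iff_order)
  have \<gamma>_0: "\<gamma> b = 0" if "b \<in> S" for b using that by (simp add: \<gamma>_def S_def tight_def)
  \<comment> \<open>The term at \<open>b\<close> divided by the term at \<open>v0\<close> after the
    substitution, without its power of \<open>\<tau>\<close>; \<open>Y\<close> collects the
    contribution from outside the cell.\<close>
  define \<kappa> where "\<kappa> T \<eta> b = spow (b - v0) * exp (\<eta> \<bullet> real_vec (b - v0) - T * \<gamma> b)" for T \<eta> b
  define Y where "Y T \<eta> = (\<Sum>b\<in>A - S. \<kappa> T \<eta> b *\<^sub>R col b)" for T \<eta>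
  \<comment> \<open>\<open>\<rho> y\<close> is what the relative terms at the vertices
    \<open>g i\<close> must be when the outside terms add up to \<open>y\<close>; \<open>H y\<close>
    is the \<open>\<eta>\<close> that gives them the right moduli.\<close>
  define \<rho> where "\<rho> y = r - B *v y" for y
  define H where "H y = N' *v (\<chi> i. ln \<bar>\<rho> y $ i\<bar>)" for y
  define \<eta>0 where "\<eta>0 = H 0"
  have \<rho>0: "\<rho> 0 = r" by (simp add: \<rho>_def)
  have cont_\<rho>: "continuous_on X \<rho>" for X
    unfolding \<rho>_def by (intro continuous_intros matrix_vector_mult_linear_continuous_on)
  have cont_H: "continuous_on X H" if "\<And>y i. y \<in> X \<Longrightarrow> \<rho> y $ i \<noteq> 0" for X
    unfolding H_def
    by (intro continuous_on_compose2[OF matrix_vector_mult_linear_continuous_on[of UNIV]]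
        continuous_on_vec_lambda continuous_on_ln continuous_on_rabs continuous_on_component cont_\<rho>)
      (use that in auto)
  \<comment> \<open>On \<open>U\<close> the components of \<open>\<rho>\<close> keep the signs of
    \<open>r\<close>, so the signs \<open>s\<close> chosen for \<open>r\<close> remain correct and
    the logarithms in \<open>H\<close> are continuous.\<close>
  define U where "U = (\<Inter>i. {y. \<rho> y $ i * sgn (r $ i) > 0})"
  have "open {y. \<rho> y $ i * sgn (r $ i) > 0}" for i
    by (intro open_Collect_less continuous_intros cont_\<rho>)
  then have "open U" unfolding U_def by auto
  have "0 \<in> U" using r_nz by (simp add: U_def \<rho>0 flip: abs_sgn)
  have U_nz: "\<rho> y $ i \<noteq> 0" "sgn (\<rho> y $ i) = sgn (r $ i)" if "y \<in> U" for y i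
    using that r_nz[of i] by (auto simp: U_def sgn_if zero_less_mult_iff dest!: spec[of _ i] split: if_splits)
  have "open (U \<inter> H -` ball \<eta>0 1)"
    using continuous_on_open_vimage[OF \<open>open U\<close>] cont_H[of U] U_nz by (auto simp: Int_commute)
  moreover have "0 \<in> U \<inter> H -` ball \<eta>0 1" using \<open>0 \<in> U\<close> by (simp add: \<eta>0_def)
  ultimately obtain \<delta> where \<delta>: "\<delta> > 0" "ball 0 \<delta> \<subseteq> U \<inter> H -` ball \<eta>0 1"
    using open_contains_ball by metis
  \<comment> \<open>The majorant is uniform over the unit ball about \<open>\<eta>0\<close>, so a
    single \<open>T0\<close> makes the perturbation small on the whole domain of the fixed point
    argument.\<close>
  have "((\<lambda>T. \<Sum>b\<in>A - S. \<bar>spow (b - v0)\<bar> * exp ((norm \<eta>0 + 1) * norm (real_vec (b - v0)) - T * \<gamma> b)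
      * norm (col b)) \<longlongrightarrow> (\<Sum>b\<in>A - S. \<bar>spow (b - v0)\<bar> * 0 * norm (col b))) at_top"
    by (intro tendsto_intros exp_decay \<gamma>_pos)
  then have "eventually (\<lambda>T. (\<Sum>b\<in>A - S. \<bar>spow (b - v0)\<bar> *
      exp ((norm \<eta>0 + 1) * norm (real_vec (b - v0)) - T * \<gamma> b) * norm (col b)) < \<delta>) at_top"
    using \<delta>(1) by (intro order_tendstoD(2)) auto
  then obtain T0 where T0: "\<And>T. T \<ge> T0 \<Longrightarrow> (\<Sum>b\<in>A - S. \<bar>spow (b - v0)\<bar> *
      exp ((norm \<eta>0 + 1) * norm (real_vec (b - v0)) - T * \<gamma> b) * norm (col b)) < \<delta>"
    by (auto simp: eventually_at_top_linorder)
  have Y_small: "Y T \<eta> \<in> ball 0 \<delta>" if T: "T \<ge> T0" and \<eta>: "\<eta> \<in> cball \<eta>0 1" for T \<eta>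
  proof -
    have "norm \<eta> \<le> norm \<eta>0 + 1"
      using \<eta> norm_triangle_sub[of \<eta> \<eta>0] by (simp add: dist_norm norm_minus_commute)
    then have "\<eta> \<bullet> x \<le> (norm \<eta>0 + 1) * norm x" for x
      using norm_cauchy_schwarz[of \<eta> x] by (meson mult_right_mono norm_ge_zero order_trans)
    then have "norm (\<kappa> T \<eta> b *\<^sub>R col b) \<le> \<bar>spow (b - v0)\<bar> *
      exp ((norm \<eta>0 + 1) * norm (real_vec (b - v0)) - T * \<gamma> b) * norm (col b)" for b
      by (auto simp: \<kappa>_def abs_mult intro!: mult_right_mono mult_left_mono)
    then have "norm (Y T \<eta>) \<le> (\<Sum>b\<in>A - S. \<bar>spow (b - v0)\<bar> *
      exp ((norm \<eta>0 + 1) * norm (real_vec (b - v0)) - T * \<gamma> b) * norm (col b))"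
      unfolding Y_def by (intro sum_norm_le)
    with T0[OF T] show ?thesis by simp
  qed
  have "\<exists>x\<in>real_sols (coef T). norm (log_norm x + T *\<^sub>R u) \<le> norm \<eta>0 + 1" if T: "T \<ge> T0" for T
  proof -
    have YU: "Y T \<eta> \<in> U" "H (Y T \<eta>) \<in> cball \<eta>0 1" if "\<eta> \<in> cball \<eta>0 1" for \<eta>
      using Y_small[OF T that] \<delta>(2) ball_subset_cball by blast+
    have "continuous_on (cball \<eta>0 1) (\<lambda>\<eta>. H (Y T \<eta>))"
    proof (rule continuous_on_compose2[OF cont_H[of U]])
      show "continuous_on (cball \<eta>0 1) (Y T)"
        unfolding Y_def \<kappa>_def by (intro continuous_intros)
    qed (use U_nz YU in auto)
    moreover have "(\<lambda>\<eta>. H (Y T \<eta>)) \<in> cball \<eta>0 1 \<rightarrow> cball \<eta>0 1" using YU by blast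
    ultimately obtain \<eta> where \<eta>: "\<eta> \<in> cball \<eta>0 1" "H (Y T \<eta>) = \<eta>"
      using brouwer[of "cball \<eta>0 1" "\<lambda>\<eta>. H (Y T \<eta>)"] by auto
    let ?y = "Y T \<eta>"
    have \<kappa>_g: "\<kappa> T \<eta> (g i) = \<rho> ?y $ i" for i
    proof -
      have "\<eta> \<bullet> real_vec (g i - v0) = ln \<bar>\<rho> ?y $ i\<bar>"
        using N_mult[of \<eta> i] \<eta>(2) unfolding H_def by (metis NN' vec_lambda_beta)
      moreover have "spow (g i - v0) = sgn (\<rho> ?y $ i)"
        using s(2)[of i] U_nz(2)[OF YU(1)[OF \<eta>(1)]] by (simp add: spow_def)
      moreover have "\<gamma> (g i) = 0" using \<gamma>_0 S(4) by auto
      ultimately show ?thesis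
        using U_nz(1)[OF YU(1)[OF \<eta>(1)], of i] by (simp add: \<kappa>_def sgn_mult_abs)
    qed
    define x where "x = (\<chi> k. complex_of_real (s $ k * exp (\<eta> $ k - T * u $ k)))"
    have x_nz: "x $ k \<noteq> 0" for k using s_nz by (simp add: x_def)
    define X where "X a = spow a * exp (\<eta> \<bullet> real_vec a - T * (u \<bullet> real_vec a + w a))" for a
    have wmono_x: "wmono T x a = complex_of_real (X a)" for a
    proof -
      have "(\<Prod>k\<in>UNIV. (s $ k * exp (\<eta> $ k - T * u $ k)) powi (a $ k))
          = spow a * exp (\<eta> \<bullet> real_vec a - T * (u \<bullet> real_vec a))"
        by (simp add: power_int_mult_distrib prod.distrib spow_def exp_power_int exp_sum[symmetric]
            inner_vec_def real_vec_def sum_distrib_left sum_subtractf[symmetric] algebra_simps)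
      then have "mono a x = complex_of_real (spow a * exp (\<eta> \<bullet> real_vec a - T * (u \<bullet> real_vec a)))"
        unfolding mono_def x_def by (simp flip: of_real_power_int of_real_prod of_real_mult)
      moreover have "exp (\<eta> \<bullet> real_vec a - T * (u \<bullet> real_vec a + w a))
          = exp (- (T * w a)) * exp (\<eta> \<bullet> real_vec a - T * (u \<bullet> real_vec a))"
        by (simp add: algebra_simps flip: exp_add)
      ultimately show ?thesis by (simp add: wmono_def X_def)
    qed
    have X_eq: "X a = X v0 * \<kappa> T \<eta> a" for a
    proof -
      have "T * (u \<bullet> real_vec v0 + w v0) = T * c" using \<gamma>_0[of v0] S(4) by (simp add: \<gamma>_def)
      moreover have "\<eta> \<bullet> real_vec (a - v0) = \<eta> \<bullet> real_vec a - \<eta> \<bullet> real_vec v0"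
        by (simp add: inner_vec_def real_vec_def algebra_simps sum_subtractf)
      ultimately show ?thesis
        using spow_nz[of v0]
        by (simp add: X_def \<kappa>_def spow_diff \<gamma>_def exp_add[symmetric] inner_diff_right algebra_simps)
    qed
    have "(\<Sum>a\<in>A. \<tau> a ^ e j * X a) = 0" for j
    proof -
      have "(\<Sum>a\<in>A. \<tau> a ^ e j * \<kappa> T \<eta> a) =
          (\<Sum>a\<in>A - S. \<tau> a ^ e j * \<kappa> T \<eta> a) + (\<Sum>a\<in>S. \<tau> a ^ e j * \<kappa> T \<eta> a)"
        by (rule sum.subset_diff[OF S(1) finite_A])
      also have "(\<Sum>a\<in>A - S. \<tau> a ^ e j * \<kappa> T \<eta> a) = ?y $ j"
        by (simp add: Y_def col_def mult.commute)
      also have "(\<Sum>a\<in>S. \<tau> a ^ e j * \<kappa> T \<eta> a) = \<tau> v0 ^ e j * \<kappa> T \<eta> v0 + (\<Sum>a\<in>range g. \<tau> a ^ e j * \<kappa> T \<eta> a)"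
        unfolding S(4) using v0 by simp
      also have "\<kappa> T \<eta> v0 = 1"
        using \<gamma>_0[of v0] S(4) by (simp add: \<kappa>_def spow_def real_vec_def zero_vec_def[symmetric])
      also have "(\<Sum>a\<in>range g. \<tau> a ^ e j * \<kappa> T \<eta> a) = (C *v \<rho> ?y) $ j"
        by (simp add: sum.reindex[OF inj_g] C_def matrix_vector_mult_def \<kappa>_g)
      also have "C *v \<rho> ?y = - col v0 - ?y"
        by (simp add: \<rho>_def r_def matrix_vector_mult_diff_distrib mult_minus CB)
      finally have "(\<Sum>a\<in>A. \<tau> a ^ e j * \<kappa> T \<eta> a) = 0" by (simp add: col_def)
      then have "X v0 * (\<Sum>a\<in>A. \<tau> a ^ e j * \<kappa> T \<eta> a) = 0" by simp
      then show ?thesis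
        unfolding sum_distrib_left by (subst X_eq) (simp add: mult.left_commute)
    qed
    then have "leval (coef T j) x = 0" for j
      unfolding leval_coef wmono_x by (simp flip: of_real_mult of_real_sum of_real_power)
    then have "x \<in> real_sols (coef T)"
      using x_nz by (auto simp: real_sols_def torus_sols_def x_def)
    moreover have "log_norm x + T *\<^sub>R u = \<eta>"
    proof -
      have "\<bar>s $ k\<bar> = 1" for k using s(1)[of k] by auto
      then show ?thesis by (simp add: vec_eq_iff log_norm_def x_def norm_mult abs_mult)
    qed
    moreover have "norm \<eta> \<le> norm \<eta>0 + 1"
      using \<eta>(1) norm_triangle_sub[of \<eta> \<eta>0] by (simp add: dist_norm norm_minus_commute)
    ultimately show ?thesis by metis
  qed
  then show ?thesis by blast
qed

end

section \<open>Separating the cells and counting real solutions\<close>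

text \<open>The maximum is bounded from below by exhibiting one admissible system with enough real
  solutions. Each odd cell has a solution whose \<open>log_norm\<close> stays within a fixed
  distance of \<open>- T\<close> times its \<open>u\<close>; as different cells have different
  \<open>u\<close>, these solutions are distinct for large \<open>T\<close>.\<close>

theorem mainTheorem2:
  fixes P :: "(real^'n) set" and w :: "int^'n \<Rightarrow> real"
  assumes "is_lattice_polytope P"
    and "aff_dim P = int CARD('n)"
    and "\<forall>a\<in>lattice_pts P. w a \<in> \<rat> \<and> w a \<ge> 0"
    and "regular_triangulation P w"
  shows "\<exists>r\<in>real_counts P. card {S \<in> cells P w. odd_cell S} \<le> r"
proof -
  define A where "A = lattice_pts P"
  define Q where "Q = lifted_polytope P w"
  have Q_eq: "Q = convex hull ((\<lambda>a. (real_vec a, w a)) ` A)"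
    by (simp add: Q_def lifted_polytope_def A_def)
  obtain V where V: "finite V" "P = convex hull (real_vec ` V)"
    using assms(1) by (auto simp: is_lattice_polytope_def)
  have "convex P" "polytope P" using V by (auto simp: polytope_convex_hull)
  have fin: "finite A"
    unfolding A_def by (intro finite_lattice_pts polytope_imp_bounded \<open>polytope P\<close>)
  have "V \<subseteq> A" by (auto simp: A_def lattice_pts_def V(2) hull_inc)
  then have "P \<subseteq> convex hull (real_vec ` A)" unfolding V(2) by (intro hull_mono image_mono)
  moreover have "real_vec ` A \<subseteq> P" by (auto simp: A_def lattice_pts_def)
  ultimately have P_eq: "P = convex hull (real_vec ` A)"
    using hull_minimal \<open>convex P\<close> by (metis subset_antisym)
  have "P \<noteq> {}" using assms(2) by auto
  then have "A \<noteq> {}" using P_eq by auto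
  have "interior P \<noteq> {}"
  proof -
    have "affine hull P = UNIV" using assms(2) by (simp add: aff_dim_eq_full[symmetric])
    then show ?thesis
      using rel_interior_interior rel_interior_eq_empty \<open>convex P\<close> \<open>P \<noteq> {}\<close> by metis
  qed
  have "polytope Q" unfolding Q_eq using fin by (intro polytope_convex_hull) simp
  have fst_Q: "fst ` Q = P"
    by (simp add: Q_eq P_eq convex_hull_linear_image[OF linear_fst] image_image)
  have facet: "\<exists>u c. lower_simplex A w u c \<and> fst ` F = convex hull (real_vec ` tight A w u c)"
    if "F \<in> lower_facets Q" for F
  proof -
    have "\<forall>a\<in>A. \<exists>F\<in>lower_facets Q. (real_vec a, w a) extreme_point_of F" "int CARD('n) simplex F"
      using assms(4) that by (auto simp: regular_triangulation_def Q_def A_def)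
    from lower_facet_imp_lower_simplex[OF fin this(1)[unfolded Q_eq] that[unfolded Q_eq] this(2)]
    show ?thesis by metis
  qed
  obtain idx :: "int^'n \<Rightarrow> nat" where idx: "inj_on idx A"
    using fin finite_imp_inj_to_nat_seg by metis
  obtain e :: "'n \<Rightarrow> nat" where e: "bij_betw e UNIV {..<CARD('n)}"
    using ex_bij_betw_finite_nat[of "UNIV :: 'n set"] by (auto simp: atLeast0LessThan)
  \<comment> \<open>Shifting the numbering by one makes the nodes positive, so no coefficient on
    \<open>A\<close> vanishes and each Newton polytope is all of \<open>P\<close>.\<close>
  interpret viro_system A w "\<lambda>a. real (idx a) + 1" e
  proof
    show "\<exists>u c. lower_simplex A w u c \<and> x \<in> convex hull (real_vec ` tight A w u c)"
      if "x \<in> convex hull (real_vec ` A)" for x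
    proof -
      have "x \<in> (\<Union>F\<in>lower_facets Q. fst ` F)"
        using lower_facets_cover[OF \<open>polytope Q\<close>] \<open>interior P \<noteq> {}\<close> that fst_Q P_eq by auto
      then obtain F where "F \<in> lower_facets Q" "x \<in> fst ` F" by blast
      then show ?thesis using facet[of F] by metis
    qed
    show "inj_on (\<lambda>a. real (idx a) + 1) A" using idx by (auto simp: inj_on_def)
  qed (use fin \<open>A \<noteq> {}\<close> e in auto)
  define Odd where "Odd = {S \<in> cells P w. odd_cell S}"
  have "finite (cells P w)"
    using finite_lower_facets[OF \<open>polytope Q\<close>] by (simp add: cells_def Q_def)
  then have "finite Odd" by (simp add: Odd_def)
  have "\<exists>u c K T0. lower_simplex A w u c \<and> S = convex hull (real_vec ` tight A w u c) \<and>
      (\<forall>T\<ge>T0. \<exists>x\<in>real_sols (coef T). norm (log_norm x + T *\<^sub>R u) \<le> K)" if S: "S \<in> Odd" for S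
  proof -
    obtain F where "F \<in> lower_facets Q" "S = fst ` F"
      using S by (auto simp: Odd_def cells_def Q_def)
    with facet[of F] obtain u c where
      uc: "lower_simplex A w u c" "S = convex hull (real_vec ` tight A w u c)" by metis
    \<comment> \<open>Affine independence identifies the tight exponents with the extreme points, in
      terms of which \<open>odd_cell\<close> is stated.\<close>
    have "finite (real_vec ` tight A w u c)" using fin by (simp add: tight_def)
    moreover have "card (real_vec ` tight A w u c) = CARD('n) + 1"
      using uc(1)
      by (simp add: lower_simplex_def card_image[OF inj_on_subset[OF inj_real_vec subset_UNIV]])
    ultimately have "\<not> affine_dependent (real_vec ` tight A w u c)"
      using uc(1) by (simp add: affine_independent_iff_card lower_simplex_def)
    then have ext: "{x. x extreme_point_of S} = real_vec ` tight A w u c"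
      using extreme_point_of_convex_hull_affine_independent uc(2) by blast
    obtain v0 and g :: "'n \<Rightarrow> int^'n" where g:
      "{x. x extreme_point_of S} = insert (real_vec v0) (real_vec ` range g)"
      "odd (det (\<chi> i j. (g j - v0) $ i))"
      using S by (auto simp: Odd_def odd_cell_def)
    have "real_vec ` tight A w u c = real_vec ` insert v0 (range g)"
      using g(1) ext by simp
    then have "tight A w u c = insert v0 (range g)"
      by (simp only: inj_image_eq_iff[OF inj_real_vec])
    from odd_simplex_real_solution[OF uc(1) this g(2)] uc show ?thesis by blast
  qed
  then obtain u c K T0 where cell: "\<And>S. S \<in> Odd \<Longrightarrow> lower_simplex A w (u S) (c S)"
      "\<And>S. S \<in> Odd \<Longrightarrow> S = convex hull (real_vec ` tight A w (u S) (c S))"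
    and sol: "\<And>S T. S \<in> Odd \<Longrightarrow> T \<ge> T0 S \<Longrightarrow> \<exists>x\<in>real_sols (coef T). norm (log_norm x + T *\<^sub>R u S) \<le> K S"
    by metis
  \<comment> \<open>\<open>c\<close> is the minimum over \<open>A\<close> of the functional given by
    \<open>u\<close>, so \<open>u\<close> alone determines the cell.\<close>
  have u_inj: "S = S'" if "S \<in> Odd" "S' \<in> Odd" "u S = u S'" for S S'
  proof -
    have le: "c S1 \<le> c S2" if S12: "S1 \<in> Odd" "S2 \<in> Odd" "u S1 = u S2" for S1 S2
    proof -
      have "tight A w (u S2) (c S2) \<noteq> {}"
        using cell(1)[OF S12(2)] by (auto simp: lower_simplex_def)
      then obtain a where "a \<in> A" "u S2 \<bullet> real_vec a + w a = c S2" by (auto simp: tight_def)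
      then show ?thesis using cell(1)[OF S12(1)] S12(3) by (auto simp: lower_simplex_def)
    qed
    have "c S = c S'" using le[of S S'] le[of S' S] that by simp
    then show ?thesis using cell(2)[OF that(1)] cell(2)[OF that(2)] that(3) by simp
  qed
  obtain T1 where T1: "\<And>T. T \<ge> T1 \<Longrightarrow> admissible_system P (coef T)"
    using admissible_coef unfolding P_eq[symmetric] by blast
  have "eventually (\<lambda>T. S \<noteq> S' \<longrightarrow> K S + K S' < T * norm (u S - u S')) at_top"
    if S: "S \<in> Odd" "S' \<in> Odd" for S S'
  proof (cases "S = S'")
    case False
    then have "u S \<noteq> u S'" using u_inj S by blast
    then have "filterlim (\<lambda>T. norm (u S - u S') * T) at_top at_top"
      by (intro filterlim_tendsto_pos_mult_at_top[OF tendsto_const _ filterlim_ident]) simp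
    then show ?thesis using False by (simp add: filterlim_at_top_dense mult.commute)
  qed simp
  then have "eventually (\<lambda>T. \<forall>S\<in>Odd. \<forall>S'\<in>Odd. S \<noteq> S' \<longrightarrow> K S + K S' < T * norm (u S - u S')) at_top"
    by (simp add: eventually_ball_finite_distrib \<open>finite Odd\<close>)
  moreover have "eventually (\<lambda>T. \<forall>S\<in>Odd. T \<ge> T0 S) at_top"
    by (simp add: eventually_ball_finite_distrib \<open>finite Odd\<close> eventually_ge_at_top)
  ultimately have "eventually (\<lambda>T. (\<forall>S\<in>Odd. \<forall>S'\<in>Odd. S \<noteq> S' \<longrightarrow> K S + K S' < T * norm (u S - u S')) \<and>
      (\<forall>S\<in>Odd. T \<ge> T0 S) \<and> T \<ge> T1 \<and> T \<ge> 0) at_top"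
    by (intro eventually_conj eventually_ge_at_top)
  from eventually_happens'[OF trivial_limit_at_top_linorder this] obtain T where
      sep: "\<forall>S\<in>Odd. \<forall>S'\<in>Odd. S \<noteq> S' \<longrightarrow> K S + K S' < T * norm (u S - u S')"
      and T: "\<forall>S\<in>Odd. T \<ge> T0 S" "T \<ge> T1" "T \<ge> 0"
    by (elim exE conjE)
  have "\<forall>S\<in>Odd. \<exists>x. x \<in> real_sols (coef T) \<and> norm (log_norm x + T *\<^sub>R u S) \<le> K S"
    using sol T(1) by blast
  from bchoice[OF this] obtain x where
    x: "\<forall>S\<in>Odd. x S \<in> real_sols (coef T) \<and> norm (log_norm (x S) + T *\<^sub>R u S) \<le> K S"
    by (elim exE)
  have "inj_on x Odd"
  proof (rule inj_onI, rule ccontr)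
    fix S S' assume S: "S \<in> Odd" "S' \<in> Odd" "x S = x S'" "S \<noteq> S'"
    \<comment> \<open>A shared solution would have its \<open>log_norm\<close> close to both
      \<open>- T\<close> times \<open>u S\<close> and \<open>- T\<close> times \<open>u S'\<close>,
      against the separation chosen for \<open>T\<close>.\<close>
    have "T *\<^sub>R (u S - u S') = (log_norm (x S) + T *\<^sub>R u S) - (log_norm (x S') + T *\<^sub>R u S')"
      using S(3) by (simp add: algebra_simps)
    then have "norm (T *\<^sub>R (u S - u S'))
        \<le> norm (log_norm (x S) + T *\<^sub>R u S) + norm (log_norm (x S') + T *\<^sub>R u S')"
      by (simp only: norm_triangle_ineq4)
    also have "\<dots> \<le> K S + K S'" using bspec[OF x S(1)] bspec[OF x S(2)] by (intro add_mono) auto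
    finally have "norm (T *\<^sub>R (u S - u S')) \<le> K S + K S'" .
    then show False using sep[rule_format, OF S(1,2,4)] T(3) by simp
  qed
  moreover have adm: "admissible_system P (coef T)" using T1 T(2) by blast
  then have "finite (real_sols (coef T))"
    by (auto simp: admissible_system_def real_sols_def)
  ultimately have "card Odd \<le> card (real_sols (coef T))"
    using x by (intro card_inj_on_le) auto
  moreover have "card (real_sols (coef T)) \<in> real_counts P"
    using adm by (auto simp: real_counts_def)
  ultimately show ?thesis unfolding Odd_def by blast
qed

end
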